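(* If $G$ is a finite non-abelian group with $\mathrm{tp}(G) > 4/81$, then $G$ is soluble of derived length exactly $2$. Furthermore, the bound is sharp: for no real number $c<4/81$ is it true that every finite non-abelian group $G$ with $\mathrm{tp}(G)>c$ has derived length $2$.
   Context: For a subgroup $H$ of index $n$ in a finite group $G$, $P_G(H) := |\mathrm{DT}_G(H)|/|H|^n$, where $\mathrm{DT}_G(H)$ is the set of all subsets of $G$ that are simultaneously a left transversal (exactly one element of each left coset $gH$) and a right transversal (exactly one element of each right coset $Hg$) of $H$ in $G$. The common transversal probability of $G$ is $\mathrm{tp}(G) := \min_{H\leq G} P_G(H)$, the minimum over all subgroups $H$ of $G$. Derived length $2$ means $G'\neq 1$ and $G''=1$. *)

theory Defs
  imports Complex_Main "HOL-Algebra.Left_Coset" "HOL-Algebra.Solvable_Groups"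
begin

definition left_transversal :: "('a, 'b) monoid_scheme \<Rightarrow> 'a set \<Rightarrow> 'a set \<Rightarrow> bool" where
  "left_transversal G H T \<longleftrightarrow>
     T \<subseteq> carrier G \<and> (\<forall>C \<in> lcosets\<^bsub>G\<^esub> H. \<exists>!x. x \<in> T \<and> x \<in> C)"

definition right_transversal :: "('a, 'b) monoid_scheme \<Rightarrow> 'a set \<Rightarrow> 'a set \<Rightarrow> bool" where
  "right_transversal G H T \<longleftrightarrow>
     T \<subseteq> carrier G \<and> (\<forall>C \<in> rcosets\<^bsub>G\<^esub> H. \<exists>!x. x \<in> T \<and> x \<in> C)"

definition DT :: "('a, 'b) monoid_scheme \<Rightarrow> 'a set \<Rightarrow> 'a set set" where
  "DT G H = {T. left_transversal G H T \<and> right_transversal G H T}"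

definition transversal_prob :: "('a, 'b) monoid_scheme \<Rightarrow> 'a set \<Rightarrow> real" where
  "transversal_prob G H = real (card (DT G H)) / real (card H) ^ card (rcosets\<^bsub>G\<^esub> H)"

text \<open>Only meaningful for finite groups, where the minimum is over a finite nonempty set.\<close>

definition tp :: "('a, 'b) monoid_scheme \<Rightarrow> real" where
  "tp G = Min (transversal_prob G ` {H. subgroup H G})"

definition derived_length_two :: "('a, 'b) monoid_scheme \<Rightarrow> bool" where
  "derived_length_two G \<longleftrightarrow>
     derived G (carrier G) \<noteq> {\<one>\<^bsub>G\<^esub>} \<and> derived G (derived G (carrier G)) = {\<one>\<^bsub>G\<^esub>}"

end

theory Submission
  imports Defs "HOL-Library.Disjoint_Sets" "HOL-Library.Countable" "HOL-Library.Numeral_Type"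
    "HOL-Computational_Algebra.Primes"
    "HOL-Algebra.Multiplicative_Group" "HOL-Algebra.Sylow" "HOL-Algebra.Group_Action"
    "HOL-Algebra.Weak_Morphisms"
begin

text \<open>A double coset \<open>D\<close> of \<open>H\<close> that consists of \<open>k\<close> left cosets also consists of \<open>k\<close> right cosets, and
  any two of them meet in the same number of elements; counting gives
  \<open>P\<^sub>G(H) = \<Prod>\<^sub>D k\<^sub>D!/k\<^sub>D\<^sup>k\<close>. If this exceeds \<open>4/81\<close> and \<open>H\<close> is a cyclic \<open>p\<close>-group that is not normal, then
  \<open>p \<le> 3\<close> and only very few double cosets lie outside the normaliser \<open>N\<close> of \<open>H\<close>: one with \<open>k = 3\<close> if
  \<open>p = 3\<close>; one with \<open>k = 4\<close>, or at most four with \<open>k = 2\<close>, if \<open>p = 2\<close>.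

  Suppose that \<open>G'\<close> is not abelian. It contains an element \<open>x\<close> of prime power order that is not central in
  \<open>G'\<close>, so \<open>H = \<langle>x\<rangle>\<close> is not normal in \<open>G\<close>. A non-normal cyclic 3-subgroup forces \<open>G'\<close> to be
  abelian, so all elements of odd prime power order generate normal subgroups and commute with \<open>x\<close>.
  Hence \<open>x\<close> is a 2-element and \<open>|G : N|\<close> is a power of 2, namely 2 or 4, and both are excluded.

  The bound is attained by the group \<open>SL(2, 3)\<close>, whose derived subgroup is the quaternion group.\<close>

section \<open>Common transversals of two maps\<close>

definition bitransversals :: "('a \<Rightarrow> 'l) \<Rightarrow> ('a \<Rightarrow> 'r) \<Rightarrow> 'a set \<Rightarrow> 'l set \<Rightarrow> 'r set \<Rightarrow> 'a set set" where
  "bitransversals l r D L R = {T. T \<subseteq> D \<and> bij_betw l T L \<and> bij_betw r T R}"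

lemma bitransversals_by_representative:
  assumes "i \<in> L"
  shows "bitransversals l r D L R =
    (\<Union>x\<in>{x\<in>D. l x = i \<and> r x \<in> R}. insert x ` bitransversals l r D (L - {i}) (R - {r x}))"
    (is "_ = (\<Union>x\<in>?F. insert x ` ?B x)")
proof (intro equalityI subsetI)
  fix T assume "T \<in> bitransversals l r D L R"
  then have T: "T \<subseteq> D" "bij_betw l T L" "bij_betw r T R" by (auto simp: bitransversals_def)
  then obtain x where x: "x \<in> T" "l x = i" using assms by (auto simp: bij_betw_def)
  then have "x \<in> ?F" using T by (auto simp: bij_betw_def)
  moreover have "T - {x} \<in> ?B x"
    using bij_betw_DiffI[OF T(2), of "{x}" "{i}"] bij_betw_DiffI[OF T(3), of "{x}" "{r x}"] T x
    by (auto simp: bitransversals_def bij_betw_def)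
  moreover have "T = insert x (T - {x})" using x by auto
  ultimately show "T \<in> (\<Union>x\<in>?F. insert x ` ?B x)" by blast
next
  fix T assume "T \<in> (\<Union>x\<in>?F. insert x ` ?B x)"
  then obtain x S where x: "x \<in> ?F" and S: "S \<in> ?B x" and T: "T = insert x S" by auto
  have "bij_betw l (S \<union> {x}) (L - {i} \<union> {i})" "bij_betw r (S \<union> {x}) (R - {r x} \<union> {r x})"
    using x S by (intro bij_betw_combine; auto simp: bitransversals_def bij_betw_def)+
  moreover have "L - {i} \<union> {i} = L" "R - {r x} \<union> {r x} = R" using assms x by auto
  ultimately show "T \<in> bitransversals l r D L R" using x S T by (simp add: bitransversals_def)
qed

lemma card_bitransversals:
  assumes "finite D" "finite L" "finite R" "card L = k" "card R = k"
    and "\<And>i j. i \<in> L \<Longrightarrow> j \<in> R \<Longrightarrow> card {x\<in>D. l x = i \<and> r x = j} = s"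
  shows "card (bitransversals l r D L R) = fact k * s ^ k"
  using assms
proof (induction k arbitrary: L R)
  case 0
  then show ?case by (simp add: bitransversals_def bij_betw_def Collect_conv_if)
next
  case (Suc k)
  then obtain i where i: "i \<in> L" by (metis card.empty ex_in_conv nat.distinct(1))
  define F where "F = {x\<in>D. l x = i \<and> r x \<in> R}"
  let ?B = "\<lambda>x. bitransversals l r D (L - {i}) (R - {r x})"
  have notin: "x \<notin> S" if "x \<in> F" "S \<in> ?B y" for x y S
    using that by (auto simp: F_def bitransversals_def bij_betw_def)
  have card_B: "card (insert x ` ?B x) = fact k * s ^ k" if "x \<in> F" for x
  proof -
    have "inj_on (insert x) (?B x)"
      by (rule inj_onI) (use notin[OF that, of _ x] in \<open>simp add: insert_ident\<close>)
    then have "card (insert x ` ?B x) = card (?B x)" by (rule card_image)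
    also have "\<dots> = fact k * s ^ k"
      by (rule Suc.IH) (use Suc.prems i that in \<open>auto simp: F_def\<close>)
    finally show ?thesis .
  qed
  have "F = (\<Union>j\<in>R. {x\<in>D. l x = i \<and> r x = j})" by (auto simp: F_def)
  then have "card F = (\<Sum>j\<in>R. card {x\<in>D. l x = i \<and> r x = j})"
    using Suc.prems by (simp add: card_UN_disjoint disjoint_iff)
  also have "\<dots> = Suc k * s" using Suc.prems i by simp
  finally have card_F: "card F = Suc k * s" .
  have "card (bitransversals l r D L R) = (\<Sum>x\<in>F. card (insert x ` ?B x))"
    unfolding bitransversals_by_representative[OF i] F_def[symmetric]
  proof (rule card_UN_disjoint)
    show "finite F" using Suc.prems by (simp add: F_def)
    show "\<forall>x\<in>F. finite (insert x ` ?B x)"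
      using Suc.prems(1) by (auto simp: bitransversals_def intro: finite_subset[of _ "Pow D"])
    show "\<forall>x\<in>F. \<forall>y\<in>F. x \<noteq> y \<longrightarrow> insert x ` ?B x \<inter> insert y ` ?B y = {}" using notin by auto
  qed
  also have "\<dots> = card F * (fact k * s ^ k)" using card_B by simp
  finally show ?case using card_F by (simp add: algebra_simps)
qed

lemma bij_betw_image_iff_partition:
  assumes P: "partition_on X P" and T: "T \<subseteq> X"
    and sep: "\<And>D E x y. D \<in> P \<Longrightarrow> E \<in> P \<Longrightarrow> x \<in> D \<Longrightarrow> y \<in> E \<Longrightarrow> f x = f y \<Longrightarrow> D = E"
  shows "bij_betw f T (f ` X) \<longleftrightarrow> (\<forall>D\<in>P. bij_betw f (T \<inter> D) (f ` D))"
proof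
  assume bij: "bij_betw f T (f ` X)"
  show "\<forall>D\<in>P. bij_betw f (T \<inter> D) (f ` D)"
  proof
    fix D assume D: "D \<in> P"
    have "f ` D \<subseteq> f ` (T \<inter> D)"
    proof
      fix c assume "c \<in> f ` D"
      then obtain x where x: "x \<in> D" "c = f x" by blast
      then have "c \<in> f ` T" using bij partition_onD1[OF P] D by (auto simp: bij_betw_def)
      then obtain t where t: "t \<in> T" "f t = f x" using x by auto
      then obtain E where E: "E \<in> P" "t \<in> E" using T partition_onD1[OF P] by blast
      then have "E = D" using sep[OF E(1) D E(2) x(1)] t by simp
      then show "c \<in> f ` (T \<inter> D)" using t E x by (metis IntI image_eqI)
    qed
    then show "bij_betw f (T \<inter> D) (f ` D)"
      using bij by (auto simp: bij_betw_def intro: inj_on_subset)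
  qed
next
  assume bij: "\<forall>D\<in>P. bij_betw f (T \<inter> D) (f ` D)"
  have "inj_on f T"
  proof (rule inj_onI)
    fix x y assume xy: "x \<in> T" "y \<in> T" "f x = f y"
    then obtain D E where DE: "D \<in> P" "x \<in> D" "E \<in> P" "y \<in> E"
      using T partition_onD1[OF P] by blast
    then have "D = E" using sep xy by blast
    then show "x = y" using bij DE xy by (auto simp: bij_betw_def inj_on_def)
  qed
  moreover have "f ` X = (\<Union>D\<in>P. f ` (T \<inter> D))"
    using bij by (simp add: partition_onD1[OF P] image_Union bij_betw_def)
  then have "f ` X \<subseteq> f ` T" by blast
  ultimately show "bij_betw f T (f ` X)" using T by (simp add: bij_betw_def image_mono subset_antisym)
qed

lemma card_subsets_by_partition:
  assumes P: "partition_on X P" and fin: "finite P"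
  shows "card {T. T \<subseteq> X \<and> (\<forall>D\<in>P. Q D (T \<inter> D))} = (\<Prod>D\<in>P. card {S. S \<subseteq> D \<and> Q D S})"
    (is "card ?A = (\<Prod>D\<in>P. card (?B D))")
proof -
  have X: "X = \<Union>P" by (rule partition_onD1[OF P])
  have glue: "(\<Union>E\<in>P. F E) \<inter> D = F D" if "F \<in> PiE P ?B" "D \<in> P" for F D
  proof -
    have "F E \<subseteq> E" if "E \<in> P" for E using that \<open>F \<in> PiE P ?B\<close> by blast
    then show ?thesis using that(2) partition_onD2[OF P] by (fastforce simp: disjoint_def)
  qed
  have "bij_betw (\<lambda>T. \<lambda>D\<in>P. T \<inter> D) ?A (PiE P ?B)"
  proof (rule bij_betwI[where g = "\<lambda>F. \<Union>D\<in>P. F D"])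
    show "(\<lambda>F. \<Union>D\<in>P. F D) \<in> PiE P ?B \<rightarrow> ?A"
    proof
      fix F assume F: "F \<in> PiE P ?B"
      then have "F D \<subseteq> D" "Q D (F D)" if "D \<in> P" for D using that by blast+
      then show "(\<Union>D\<in>P. F D) \<in> ?A" using X glue[OF F] by auto
    qed
    show "(\<lambda>D\<in>P. (\<Union>E\<in>P. F E) \<inter> D) = F" if "F \<in> PiE P ?B" for F
      using glue[OF that] PiE_arb[OF that] by (auto simp: fun_eq_iff)
  qed (use X in auto)
  then show ?thesis using fin by (simp add: bij_betw_same_card card_PiE)
qed

lemma card_bitransversals_partition:
  assumes P: "partition_on X P" and fin: "finite P"
    and sep: "\<And>D E x y. D \<in> P \<Longrightarrow> E \<in> P \<Longrightarrow> x \<in> D \<Longrightarrow> y \<in> E \<Longrightarrow> l x = l y \<or> r x = r y \<Longrightarrow> D = E"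
  shows "card (bitransversals l r X (l ` X) (r ` X)) =
    (\<Prod>D\<in>P. card (bitransversals l r D (l ` D) (r ` D)))"
proof -
  have "bij_betw l T (l ` X) \<and> bij_betw r T (r ` X) \<longleftrightarrow>
      (\<forall>D\<in>P. bij_betw l (T \<inter> D) (l ` D) \<and> bij_betw r (T \<inter> D) (r ` D))" if "T \<subseteq> X" for T
    using bij_betw_image_iff_partition[OF P that, of l] bij_betw_image_iff_partition[OF P that, of r] sep
    by blast
  then have "bitransversals l r X (l ` X) (r ` X) =
      {T. T \<subseteq> X \<and> (\<forall>D\<in>P. bij_betw l (T \<inter> D) (l ` D) \<and> bij_betw r (T \<inter> D) (r ` D))}"
    by (auto simp: bitransversals_def)
  then show ?thesis
    using card_subsets_by_partition[OF P fin, of "\<lambda>D S. bij_betw l S (l ` D) \<and> bij_betw r S (r ` D)"]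
    by (simp add: bitransversals_def)
qed

lemma ex1_mem_blocks_iff_bij_betw:
  assumes T: "T \<subseteq> X" and mem: "\<And>x y. x \<in> X \<Longrightarrow> y \<in> X \<Longrightarrow> x \<in> c y \<longleftrightarrow> c x = c y"
  shows "(\<forall>C\<in>c ` X. \<exists>!x. x \<in> T \<and> x \<in> C) \<longleftrightarrow> bij_betw c T (c ` X)"
proof -
  have "(\<forall>C\<in>c ` X. \<exists>!x. x \<in> T \<and> x \<in> C) \<longleftrightarrow> (\<forall>y\<in>X. \<exists>!x. x \<in> T \<and> c x = c y)"
    using T mem by (simp add: subset_iff cong: conj_cong)
  also have "\<dots> \<longleftrightarrow> inj_on c T \<and> c ` X \<subseteq> c ` T"
  proof (intro iffI conjI)
    assume unique: "\<forall>y\<in>X. \<exists>!x. x \<in> T \<and> c x = c y"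
    show "inj_on c T" using unique T by (intro inj_onI) blast
    show "c ` X \<subseteq> c ` T"
    proof (rule image_subsetI)
      fix y assume "y \<in> X"
      then obtain x where "x \<in> T" "c x = c y" using unique by blast
      then show "c y \<in> c ` T" by (metis imageI)
    qed
  next
    assume bij: "inj_on c T \<and> c ` X \<subseteq> c ` T"
    show "\<forall>y\<in>X. \<exists>!x. x \<in> T \<and> c x = c y"
    proof
      fix y assume "y \<in> X"
      then obtain x where "x \<in> T" "c y = c x" using bij by blast
      then show "\<exists>!x. x \<in> T \<and> c x = c y" using inj_on_eq_iff[OF conjunct1[OF bij]] by auto
    qed
  qed
  finally show ?thesis using T by (auto simp: bij_betw_def)
qed

lemma card_eq_card_image_mult:
  assumes "finite A" "\<And>x. x \<in> A \<Longrightarrow> card {z\<in>A. f z = f x} = n"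
  shows "card A = card (f ` A) * n"
proof -
  have "card A = (\<Sum>y\<in>f ` A. card {z\<in>A. f z = y})"
    using sum.image_gen[OF assms(1), of "\<lambda>_. 1::nat" f] by simp
  also have "\<dots> = (\<Sum>y\<in>f ` A. n)" using assms(2) by (intro sum.cong) auto
  finally show ?thesis by simp
qed

section \<open>Double cosets and the transversal probability\<close>

context group
begin

definition conjugate :: "'a \<Rightarrow> 'a \<Rightarrow> 'a" where
  "conjugate g x = g \<otimes> x \<otimes> inv g"

definition double_coset :: "'a set \<Rightarrow> 'a \<Rightarrow> 'a set" where
  "double_coset H g = {h \<otimes> g \<otimes> h' | h h'. h \<in> H \<and> h' \<in> H}"

definition double_cosets :: "'a set \<Rightarrow> 'a set set" where
  "double_cosets H = double_coset H ` carrier G"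

definition coset_count :: "'a set \<Rightarrow> 'a set \<Rightarrow> nat" where
  "coset_count H D = card ((\<lambda>x. x <# H) ` D)"

lemma inv_mult_cancel: "x \<in> carrier G \<Longrightarrow> y \<in> carrier G \<Longrightarrow> inv x \<otimes> (x \<otimes> y) = y"
  by (simp add: m_assoc[symmetric])

lemma mult_inv_cancel: "x \<in> carrier G \<Longrightarrow> y \<in> carrier G \<Longrightarrow> x \<otimes> (inv x \<otimes> y) = y"
  by (simp add: m_assoc[symmetric])

text \<open>A complete rewriting system for free groups.\<close>

lemmas group_word_simps = m_assoc inv_mult_group inv_mult_cancel mult_inv_cancel

lemma l_coset_mem_iff:
  assumes "subgroup H G" "x \<in> carrier G" "y \<in> carrier G"
  shows "x \<in> y <# H \<longleftrightarrow> x <# H = y <# H"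
  using l_repr_independence[of x y H] lcos_self[of x H] assms by auto

lemma r_coset_mem_iff:
  assumes "subgroup H G" "x \<in> carrier G" "y \<in> carrier G"
  shows "x \<in> H #> y \<longleftrightarrow> H #> x = H #> y"
  using repr_independence[of x H y] rcos_self[of x H] assms by auto

lemma l_coset_eq_iff:
  assumes "subgroup H G" "x \<in> carrier G" "y \<in> carrier G"
  shows "x <# H = y <# H \<longleftrightarrow> inv y \<otimes> x \<in> H"
  using l_coset_mem_iff[OF assms] subgroup.lcos_module_imp[OF assms(1) is_group assms(3)]
    subgroup.lcos_module_rev[OF assms(1) is_group assms(3,2)] by blast

lemma r_coset_eq_iff:
  assumes "subgroup H G" "x \<in> carrier G" "y \<in> carrier G"
  shows "H #> x = H #> y \<longleftrightarrow> x \<otimes> inv y \<in> H"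
  using r_coset_mem_iff[OF assms] subgroup.rcos_module[OF assms(1) is_group assms(3,2)] by blast

context
  fixes H
  assumes H: "subgroup H G"
begin

interpretation H: subgroup H G by (rule H)

lemma double_coset_self: "g \<in> carrier G \<Longrightarrow> g \<in> double_coset H g"
  unfolding double_coset_def using H.one_closed l_one[of g] r_one[of g] by (auto intro!: exI[of _ \<one>])

lemma double_coset_subset: "g \<in> carrier G \<Longrightarrow> double_coset H g \<subseteq> carrier G"
  by (auto simp: double_coset_def)

lemma double_coset_subset_of_mem:
  assumes g: "g \<in> carrier G" and x: "x \<in> double_coset H g"
  shows "double_coset H x \<subseteq> double_coset H g"
proof
  obtain h h' where h: "h \<in> H" "h' \<in> H" "x = h \<otimes> g \<otimes> h'" using x by (auto simp: double_coset_def)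
  fix z assume "z \<in> double_coset H x"
  then obtain a b where ab: "a \<in> H" "b \<in> H" "z = a \<otimes> x \<otimes> b" by (auto simp: double_coset_def)
  then have "z = (a \<otimes> h) \<otimes> g \<otimes> (h' \<otimes> b)" using h g by (simp add: m_assoc)
  then show "z \<in> double_coset H g" using ab h unfolding double_coset_def by blast
qed

lemma double_coset_eq:
  assumes g: "g \<in> carrier G" and x: "x \<in> double_coset H g"
  shows "double_coset H x = double_coset H g"
proof
  obtain h h' where h: "h \<in> H" "h' \<in> H" "x = h \<otimes> g \<otimes> h'" using x by (auto simp: double_coset_def)
  then have "g = inv h \<otimes> x \<otimes> inv h'" using g by (simp add: group_word_simps)
  then have "g \<in> double_coset H x" using h unfolding double_coset_def by blast
  moreover have "x \<in> carrier G" using x double_coset_subset[OF g] by blast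
  ultimately show "double_coset H g \<subseteq> double_coset H x" by (intro double_coset_subset_of_mem)
qed (rule double_coset_subset_of_mem[OF g x])

lemma double_cosets_mem_eq: "D \<in> double_cosets H \<Longrightarrow> x \<in> D \<Longrightarrow> D = double_coset H x"
  using double_coset_eq by (auto simp: double_cosets_def)

lemma double_coset_cong:
  assumes x: "x \<in> carrier G" and y: "y \<in> carrier G" and eq: "x <# H = y <# H \<or> H #> x = H #> y"
  shows "double_coset H x = double_coset H y"
proof (rule double_coset_eq[OF y])
  have "x = \<one> \<otimes> y \<otimes> (inv y \<otimes> x)" "x = (x \<otimes> inv y) \<otimes> y \<otimes> \<one>"
    using x y by (simp_all add: group_word_simps)
  moreover have "inv y \<otimes> x \<in> H \<or> x \<otimes> inv y \<in> H"
    using eq l_coset_eq_iff[OF H x y] r_coset_eq_iff[OF H x y] by blast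
  ultimately show "x \<in> double_coset H y" unfolding double_coset_def using H.one_closed by blast
qed

lemma partition_on_double_cosets: "partition_on (carrier G) (double_cosets H)"
proof (rule partition_onI)
  show "\<Union>(double_cosets H) = carrier G"
    using double_coset_self double_coset_subset by (auto simp: double_cosets_def)
  show "{} \<notin> double_cosets H" using double_coset_self by (auto simp: double_cosets_def)
  show "disjnt D E" if "D \<in> double_cosets H" "E \<in> double_cosets H" "D \<noteq> E" for D E
    using double_cosets_mem_eq[OF that(1)] double_cosets_mem_eq[OF that(2)] that(3)
    by (auto simp: disjnt_iff)
qed

lemma r_coset_subset_double_coset:
  assumes g: "g \<in> carrier G"
  shows "H #> g \<subseteq> double_coset H g"
proof
  fix x assume x: "x \<in> H #> g"
  then have xc: "x \<in> carrier G" using H.elemrcos_carrier[OF is_group g] by blast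
  then have "H #> x = H #> g" using x r_coset_mem_iff[OF H _ g] by blast
  then show "x \<in> double_coset H g" using double_coset_cong[OF xc g] double_coset_self[OF xc] by simp
qed

lemma l_coset_subset_double_coset:
  assumes g: "g \<in> carrier G"
  shows "g <# H \<subseteq> double_coset H g"
proof
  fix x assume x: "x \<in> g <# H"
  then have xc: "x \<in> carrier G" using l_coset_carrier[OF _ g H] by blast
  then have "x <# H = g <# H" using x l_coset_mem_iff[OF H _ g] by blast
  then show "x \<in> double_coset H g" using double_coset_cong[OF xc g] double_coset_self[OF xc] by simp
qed

lemma double_cosets_l_coset_iff:
  assumes D: "D \<in> double_cosets H" "x \<in> D"
  shows "z \<in> x <# H \<longleftrightarrow> z \<in> D \<and> z <# H = x <# H"
proof -
  have DG: "D \<subseteq> carrier G" using D(1) partition_onD1[OF partition_on_double_cosets] by blast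
  then have x: "x \<in> carrier G" using D(2) by blast
  have "x <# H \<subseteq> D" using l_coset_subset_double_coset[OF x] double_cosets_mem_eq[OF D] by simp
  then show ?thesis using l_coset_mem_iff[OF H _ x] DG by blast
qed

lemma double_cosets_r_coset_iff:
  assumes D: "D \<in> double_cosets H" "x \<in> D"
  shows "z \<in> H #> x \<longleftrightarrow> z \<in> D \<and> H #> z = H #> x"
proof -
  have DG: "D \<subseteq> carrier G" using D(1) partition_onD1[OF partition_on_double_cosets] by blast
  then have x: "x \<in> carrier G" using D(2) by blast
  have "H #> x \<subseteq> D" using r_coset_subset_double_coset[OF x] double_cosets_mem_eq[OF D] by simp
  then show ?thesis using r_coset_mem_iff[OF H _ x] DG by blast
qed

lemma card_l_coset_Int_r_coset:
  assumes g: "g \<in> carrier G" and x: "x \<in> double_coset H g" and y: "y \<in> double_coset H g"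
  shows "card ((x <# H) \<inter> (H #> y)) = card (H \<inter> conjugate g ` H)"
proof -
  obtain a b where ab: "a \<in> H" "b \<in> H" "x = a \<otimes> g \<otimes> b" using x by (auto simp: double_coset_def)
  obtain c d where cd: "c \<in> H" "d \<in> H" "y = c \<otimes> g \<otimes> d" using y by (auto simp: double_coset_def)
  let ?f = "\<lambda>h. a \<otimes> h \<otimes> g \<otimes> d"
  have "?f ` (H \<inter> conjugate g ` H) = (x <# H) \<inter> (H #> y)"
  proof (intro equalityI subsetI)
    fix z assume "z \<in> ?f ` (H \<inter> conjugate g ` H)"
    then obtain h k where h: "h \<in> H" "k \<in> H" "h = conjugate g k" "z = ?f h" by blast
    have "z = x \<otimes> (inv b \<otimes> k \<otimes> d)"
      unfolding h(4) unfolding h(3) using h(2) ab cd g by (simp add: conjugate_def group_word_simps)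
    moreover have "z = (a \<otimes> h \<otimes> inv c) \<otimes> y" using h ab cd g by (simp add: group_word_simps)
    moreover have "inv b \<otimes> k \<otimes> d \<in> H" "a \<otimes> h \<otimes> inv c \<in> H" using h(1,2) ab cd by simp_all
    ultimately show "z \<in> (x <# H) \<inter> (H #> y)" unfolding l_coset_def r_coset_def by blast
  next
    fix z assume "z \<in> (x <# H) \<inter> (H #> y)"
    then obtain k l where kl: "k \<in> H" "z = x \<otimes> k" "l \<in> H" "z = l \<otimes> y"
      by (auto simp: l_coset_def r_coset_def)
    define h where "h = inv a \<otimes> l \<otimes> c"
    have z: "z = ?f h" using kl(3,4) ab cd g by (simp add: h_def group_word_simps)
    have "h = inv a \<otimes> (l \<otimes> y) \<otimes> inv d \<otimes> inv g"
      using kl(3) ab cd g by (simp add: h_def group_word_simps)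
    also have "l \<otimes> y = x \<otimes> k" using kl by simp
    also have "inv a \<otimes> (x \<otimes> k) \<otimes> inv d \<otimes> inv g = conjugate g (b \<otimes> k \<otimes> inv d)"
      using kl(1) ab cd g by (simp add: conjugate_def group_word_simps)
    finally have "h \<in> conjugate g ` H" using kl ab cd by blast
    moreover have "h \<in> H" using kl ab cd by (simp add: h_def)
    ultimately show "z \<in> ?f ` (H \<inter> conjugate g ` H)" using z by blast
  qed
  then have "card ((x <# H) \<inter> (H #> y)) = card (?f ` (H \<inter> conjugate g ` H))" by simp
  also have "\<dots> = card (H \<inter> conjugate g ` H)"
    using ab cd g by (intro card_image) (auto simp: inj_on_def)
  finally show ?thesis .
qed

lemma l_coset_image_double_coset:
  assumes g: "g \<in> carrier G"
  shows "(\<lambda>x. x <# H) ` double_coset H g = (\<lambda>x. x <# H) ` (H #> g)"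
proof (rule equalityI)
  show "(\<lambda>x. x <# H) ` double_coset H g \<subseteq> (\<lambda>x. x <# H) ` (H #> g)"
  proof (rule image_subsetI)
    fix x assume "x \<in> double_coset H g"
    then obtain h h' where h: "h \<in> H" "h' \<in> H" "x = h \<otimes> g \<otimes> h'" by (auto simp: double_coset_def)
    then have "x <# H = (h \<otimes> g) <# H"
      using g by (subst l_coset_eq_iff[OF H]) (simp_all add: group_word_simps)
    then show "x <# H \<in> (\<lambda>x. x <# H) ` (H #> g)" using rcosI[OF h(1) H.subset g] by simp
  qed
qed (intro image_mono r_coset_subset_double_coset g)

lemma r_coset_image_double_coset:
  assumes g: "g \<in> carrier G"
  shows "(\<lambda>x. H #> x) ` double_coset H g = (\<lambda>x. H #> x) ` (g <# H)"
proof (rule equalityI)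
  show "(\<lambda>x. H #> x) ` double_coset H g \<subseteq> (\<lambda>x. H #> x) ` (g <# H)"
  proof (rule image_subsetI)
    fix x assume "x \<in> double_coset H g"
    then obtain h h' where h: "h \<in> H" "h' \<in> H" "x = h \<otimes> g \<otimes> h'" by (auto simp: double_coset_def)
    then have "H #> x = H #> (g \<otimes> h')"
      using g by (subst r_coset_eq_iff[OF H]) (simp_all add: group_word_simps)
    moreover have "g \<otimes> h' \<in> g <# H" using h by (auto simp: l_coset_def)
    ultimately show "H #> x \<in> (\<lambda>x. H #> x) ` (g <# H)" by simp
  qed
qed (intro image_mono l_coset_subset_double_coset g)

context
  assumes fin: "finite (carrier G)"
begin

lemma finite_subgroup_carrier: "finite H"
  using finite_subset[OF H.subset fin] .

lemma card_subgroup_pos: "card H > 0"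
  using finite_subgroup_carrier H.one_closed by (metis card_gt_0_iff empty_iff)

lemma finite_double_cosets: "finite (double_cosets H)"
  using fin by (simp add: double_cosets_def)

lemma card_l_coset: "x \<in> carrier G \<Longrightarrow> card (x <# H) = card H"
  by (rule l_card_cosets_equal[OF _ H.subset fin, symmetric]) (auto simp: LCOSETS_def)

lemma card_r_coset: "x \<in> carrier G \<Longrightarrow> card (H #> x) = card H"
  using card_rcosets_equal[OF rcosetsI[OF H.subset] H.subset] by simp

lemma coset_count_double_coset:
  assumes g: "g \<in> carrier G"
  shows "coset_count H (double_coset H g) * card (H \<inter> conjugate g ` H) = card H"
proof -
  have "card {z \<in> H #> g. z <# H = x <# H} = card (H \<inter> conjugate g ` H)" if x: "x \<in> H #> g" for x
  proof -
    have "{z \<in> H #> g. z <# H = x <# H} = (x <# H) \<inter> (H #> g)"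
      using x l_coset_mem_iff[OF H] H.elemrcos_carrier[OF is_group g] by blast
    then show ?thesis
      using x card_l_coset_Int_r_coset[OF g _ double_coset_self[OF g]] r_coset_subset_double_coset[OF g] by auto
  qed
  then have "card (H #> g) = coset_count H (double_coset H g) * card (H \<inter> conjugate g ` H)"
    unfolding coset_count_def l_coset_image_double_coset[OF g]
    using card_r_coset[OF g] card_subgroup_pos by (intro card_eq_card_image_mult card_ge_0_finite) simp_all
  then show ?thesis using card_r_coset[OF g] by simp
qed

lemma card_r_coset_image_double_coset:
  assumes g: "g \<in> carrier G"
  shows "card ((\<lambda>x. H #> x) ` double_coset H g) = coset_count H (double_coset H g)"
proof -
  have "card {z \<in> g <# H. H #> z = H #> x} = card (H \<inter> conjugate g ` H)" if x: "x \<in> g <# H" for x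
  proof -
    have "{z \<in> g <# H. H #> z = H #> x} = (g <# H) \<inter> (H #> x)"
      using x r_coset_mem_iff[OF H] l_coset_carrier[OF _ g H] by blast
    then show ?thesis
      using x card_l_coset_Int_r_coset[OF g double_coset_self[OF g]] l_coset_subset_double_coset[OF g] by auto
  qed
  then have "card (g <# H) = card ((\<lambda>x. H #> x) ` double_coset H g) * card (H \<inter> conjugate g ` H)"
    unfolding r_coset_image_double_coset[OF g]
    using card_l_coset[OF g] card_subgroup_pos by (intro card_eq_card_image_mult card_ge_0_finite) simp_all
  then show ?thesis
    using card_l_coset[OF g] coset_count_double_coset[OF g] card_subgroup_pos
    by (metis mult_0_right mult_right_cancel less_not_refl)
qed

lemma card_double_cosets_mem:
  assumes D: "D \<in> double_cosets H"
  shows "card D = coset_count H D * card H"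
  unfolding coset_count_def
proof (rule card_eq_card_image_mult)
  have DG: "D \<subseteq> carrier G" using D partition_onD1[OF partition_on_double_cosets] by blast
  then show "finite D" using fin finite_subset by blast
  fix x assume x: "x \<in> D"
  then have "{z\<in>D. z <# H = x <# H} = x <# H" using double_cosets_l_coset_iff[OF D x] by blast
  then show "card {z\<in>D. z <# H = x <# H} = card H" using card_l_coset x DG by auto
qed

lemma coset_count_dvd: "D \<in> double_cosets H \<Longrightarrow> coset_count H D dvd card H"
  using coset_count_double_coset by (metis double_cosets_def dvd_triv_left imageE)

lemma coset_count_pos: "D \<in> double_cosets H \<Longrightarrow> coset_count H D > 0"
  using coset_count_dvd card_subgroup_pos by (metis dvd_0_left gr0I less_not_refl)

lemma card_UN_double_cosets:
  assumes "S \<subseteq> double_cosets H"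
  shows "card (\<Union>S) = (\<Sum>D\<in>S. coset_count H D) * card H"
proof -
  have "card (\<Union>S) = (\<Sum>D\<in>S. card D)"
  proof (rule card_Union_disjoint)
    show "disjoint S"
      using partition_onD2[OF partition_on_double_cosets] assms by (rule pairwise_subset)
    show "finite D" if "D \<in> S" for D
      using partition_onD1[OF partition_on_double_cosets] fin assms that by (metis Union_upper finite_subset subsetD)
  qed
  also have "\<dots> = (\<Sum>D\<in>S. coset_count H D) * card H"
    using assms card_double_cosets_mem by (simp add: sum_distrib_right subset_iff)
  finally show ?thesis .
qed

lemma sum_coset_count: "(\<Sum>D\<in>double_cosets H. coset_count H D) = card (rcosets H)"
proof -
  have "(\<Sum>D\<in>double_cosets H. coset_count H D) * card H = card (\<Union>(double_cosets H))"
    by (rule card_UN_double_cosets[OF order_refl, symmetric])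
  also have "\<dots> = order G" by (simp add: order_def partition_onD1[OF partition_on_double_cosets])
  also have "\<dots> = card (rcosets H) * card H" using lagrange[OF H] by simp
  finally show ?thesis using card_subgroup_pos by (metis mult_right_cancel less_not_refl)
qed

end

end

end

definition fact_ratio :: "nat \<Rightarrow> real" where
  "fact_ratio k = fact k / real k ^ k"

lemma fact_ratio_pos: "0 < fact_ratio k"
  by (cases "k = 0") (auto simp: fact_ratio_def)

lemma fact_ratio_antimono: "i \<le> j \<Longrightarrow> fact_ratio j \<le> fact_ratio i"
proof (induction rule: dec_induct)
  case (step n)
  have "fact_ratio (Suc n) \<le> fact_ratio n"
  proof (cases "n = 0")
    case False
    have "fact_ratio (Suc n) = fact n / real (Suc n) ^ n"
      by (simp add: fact_ratio_def field_simps del: of_nat_Suc)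
    also have "\<dots> \<le> fact n / real n ^ n"
      using False by (intro divide_left_mono power_mono mult_pos_pos) auto
    finally show ?thesis by (simp add: fact_ratio_def)
  qed (simp add: fact_ratio_def)
  then show ?case using step.IH by linarith
qed simp

lemma fact_ratio_small:
  "fact_ratio 1 = 1" "fact_ratio 2 = 1/2" "fact_ratio 3 = 2/9" "fact_ratio 4 = 3/32"
  "fact_ratio 5 = 24/625"
  by (simp_all add: fact_ratio_def fact_numeral)

lemma fact_ratio_le_one: "fact_ratio k \<le> 1"
  using fact_ratio_antimono[of 0 k] by (simp add: fact_ratio_def)

context group
begin

context
  fixes H
  assumes H: "subgroup H G"
begin

lemma left_transversal_iff:
  "left_transversal G H T \<longleftrightarrow>
    T \<subseteq> carrier G \<and> bij_betw (\<lambda>x. x <# H) T ((\<lambda>x. x <# H) ` carrier G)"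
proof -
  have "lcosets H = (\<lambda>x. x <# H) ` carrier G" by (auto simp: LCOSETS_def)
  then show ?thesis
    using ex1_mem_blocks_iff_bij_betw[of T "carrier G" "\<lambda>x. x <# H"] l_coset_mem_iff[OF H]
    by (auto simp: left_transversal_def)
qed

lemma right_transversal_iff:
  "right_transversal G H T \<longleftrightarrow>
    T \<subseteq> carrier G \<and> bij_betw (\<lambda>x. H #> x) T ((\<lambda>x. H #> x) ` carrier G)"
proof -
  have "rcosets H = (\<lambda>x. H #> x) ` carrier G" by (auto simp: RCOSETS_def)
  then show ?thesis
    using ex1_mem_blocks_iff_bij_betw[of T "carrier G" "\<lambda>x. H #> x"] r_coset_mem_iff[OF H]
    by (auto simp: right_transversal_def)
qed

lemma DT_eq_bitransversals:
  "DT G H = bitransversals (\<lambda>x. x <# H) (\<lambda>x. H #> x) (carrier G)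
    ((\<lambda>x. x <# H) ` carrier G) ((\<lambda>x. H #> x) ` carrier G)"
  by (auto simp: DT_def bitransversals_def left_transversal_iff right_transversal_iff)

context
  assumes fin: "finite (carrier G)"
begin

lemma card_bitransversals_double_coset:
  assumes D: "D \<in> double_cosets H"
  shows "real (card (bitransversals (\<lambda>x. x <# H) (\<lambda>x. H #> x) D
      ((\<lambda>x. x <# H) ` D) ((\<lambda>x. H #> x) ` D))) =
    fact_ratio (coset_count H D) * real (card H) ^ coset_count H D"
proof -
  obtain g where g: "g \<in> carrier G" "D = double_coset H g" using D by (auto simp: double_cosets_def)
  let ?s = "card (H \<inter> conjugate g ` H)" and ?k = "coset_count H D"
  have DG: "D \<subseteq> carrier G" using double_coset_subset[OF H] g by blast
  have "card (bitransversals (\<lambda>x. x <# H) (\<lambda>x. H #> x) D ((\<lambda>x. x <# H) ` D) ((\<lambda>x. H #> x) ` D))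
      = fact ?k * ?s ^ ?k"
  proof (rule card_bitransversals)
    fix i j assume "i \<in> (\<lambda>x. x <# H) ` D" "j \<in> (\<lambda>x. H #> x) ` D"
    then obtain x y where xy: "x \<in> D" "y \<in> D" "i = x <# H" "j = H #> y" by blast
    then have "{z \<in> D. z <# H = i \<and> H #> z = j} = (x <# H) \<inter> (H #> y)"
      using double_cosets_l_coset_iff[OF H D xy(1)] double_cosets_r_coset_iff[OF H D xy(2)] by auto
    then show "card {z \<in> D. z <# H = i \<and> H #> z = j} = ?s"
      using card_l_coset_Int_r_coset[OF H g(1)] xy g(2) by simp
  qed (use finite_subset[OF DG fin] card_r_coset_image_double_coset[OF H fin g(1)] g in
      \<open>simp_all add: coset_count_def\<close>)
  moreover have "real (card H) ^ ?k = real ?k ^ ?k * real ?s ^ ?k"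
    using coset_count_double_coset[OF H fin g(1)] g(2)
    by (simp flip: of_nat_mult power_mult_distrib)
  ultimately show ?thesis using coset_count_pos[OF H fin D] by (simp add: fact_ratio_def)
qed

theorem transversal_prob_eq_prod:
  "transversal_prob G H = (\<Prod>D\<in>double_cosets H. fact_ratio (coset_count H D))"
proof -
  have "card (DT G H) = (\<Prod>D\<in>double_cosets H.
      card (bitransversals (\<lambda>x. x <# H) (\<lambda>x. H #> x) D ((\<lambda>x. x <# H) ` D) ((\<lambda>x. H #> x) ` D)))"
    unfolding DT_eq_bitransversals
  proof (rule card_bitransversals_partition[where l = "\<lambda>x. x <# H" and r = "\<lambda>x. H #> x"])
    show "partition_on (carrier G) (double_cosets H)" by (rule partition_on_double_cosets[OF H])
    show "finite (double_cosets H)" by (rule finite_double_cosets[OF H fin])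
    fix D E x y
    assume D: "D \<in> double_cosets H" "x \<in> D" and E: "E \<in> double_cosets H" "y \<in> E"
      and eq: "x <# H = y <# H \<or> H #> x = H #> y"
    have "x \<in> carrier G" "y \<in> carrier G"
      using D E partition_onD1[OF partition_on_double_cosets[OF H]] by blast+
    then have "double_coset H x = double_coset H y" using eq by (rule double_coset_cong[OF H])
    then show "D = E" using double_cosets_mem_eq[OF H D] double_cosets_mem_eq[OF H E] by simp
  qed
  then have "real (card (DT G H)) =
      (\<Prod>D\<in>double_cosets H. fact_ratio (coset_count H D) * real (card H) ^ coset_count H D)"
    by (simp add: card_bitransversals_double_coset)
  also have "\<dots> = (\<Prod>D\<in>double_cosets H. fact_ratio (coset_count H D)) * real (card H) ^ card (rcosets H)"
    by (simp add: prod.distrib power_sum[symmetric] sum_coset_count[OF H fin])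
  finally show ?thesis using card_subgroup_pos[OF H fin] by (simp add: transversal_prob_def)
qed

end

end

end

section \<open>Conjugation and normalisers\<close>

context group
begin

abbreviation cyclic :: "'a \<Rightarrow> 'a set" (\<open>\<langle>_\<rangle>\<close>) where
  "\<langle>x\<rangle> \<equiv> generate G {x}"

lemma conjugate_closed [simp]: "a \<in> carrier G \<Longrightarrow> x \<in> carrier G \<Longrightarrow> conjugate a x \<in> carrier G"
  by (simp add: conjugate_def)

lemma conjugate_mult:
  "a \<in> carrier G \<Longrightarrow> x \<in> carrier G \<Longrightarrow> y \<in> carrier G \<Longrightarrow> conjugate a (x \<otimes> y) = conjugate a x \<otimes> conjugate a y"
  by (simp add: conjugate_def group_word_simps)

lemma conjugate_inv: "a \<in> carrier G \<Longrightarrow> x \<in> carrier G \<Longrightarrow> conjugate a (inv x) = inv (conjugate a x)"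
  by (simp add: conjugate_def group_word_simps)

lemma conjugate_one [simp]: "a \<in> carrier G \<Longrightarrow> conjugate a \<one> = \<one>"
  by (simp add: conjugate_def)

lemma one_conjugate [simp]: "x \<in> carrier G \<Longrightarrow> conjugate \<one> x = x"
  by (simp add: conjugate_def)

lemma conjugate_conjugate:
  "a \<in> carrier G \<Longrightarrow> b \<in> carrier G \<Longrightarrow> x \<in> carrier G \<Longrightarrow> conjugate a (conjugate b x) = conjugate (a \<otimes> b) x"
  by (simp add: conjugate_def group_word_simps)

lemma conjugate_nat_pow:
  "a \<in> carrier G \<Longrightarrow> x \<in> carrier G \<Longrightarrow> conjugate a (x [^] (n::nat)) = conjugate a x [^] n"
  by (induction n) (simp_all add: conjugate_mult)

lemma conjugate_inject:
  "a \<in> carrier G \<Longrightarrow> x \<in> carrier G \<Longrightarrow> y \<in> carrier G \<Longrightarrow> conjugate a x = conjugate a y \<longleftrightarrow> x = y"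
  by (simp add: conjugate_def)

lemma conjugate_eq_iff:
  "a \<in> carrier G \<Longrightarrow> x \<in> carrier G \<Longrightarrow> y \<in> carrier G \<Longrightarrow> conjugate a x = y \<longleftrightarrow> x = conjugate (inv a) y"
  by (auto simp: conjugate_def group_word_simps)

lemma conjugate_eq_self_iff:
  "a \<in> carrier G \<Longrightarrow> x \<in> carrier G \<Longrightarrow> conjugate a x = x \<longleftrightarrow> a \<otimes> x = x \<otimes> a"
  by (metis conjugate_def inv_solve_right' m_closed)

lemma group_hom_conjugate: "a \<in> carrier G \<Longrightarrow> group_hom G G (conjugate a)"
  by (intro group_hom.intro group_hom_axioms.intro is_group homI) (simp_all add: conjugate_mult)

lemma inj_on_conjugate: "a \<in> carrier G \<Longrightarrow> H \<subseteq> carrier G \<Longrightarrow> inj_on (conjugate a) H"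
  by (intro inj_onI) (simp add: conjugate_inject subset_iff)

lemma card_conjugate_image: "a \<in> carrier G \<Longrightarrow> H \<subseteq> carrier G \<Longrightarrow> card (conjugate a ` H) = card H"
  by (intro card_image inj_on_conjugate)

lemma subgroup_conjugate_image: "a \<in> carrier G \<Longrightarrow> subgroup H G \<Longrightarrow> subgroup (conjugate a ` H) G"
  using group_hom.subgroup_img_is_subgroup[OF group_hom_conjugate] .

lemma conjugate_image_generate:
  "a \<in> carrier G \<Longrightarrow> S \<subseteq> carrier G \<Longrightarrow> conjugate a ` generate G S = generate G (conjugate a ` S)"
  using group_hom.generate_img[OF group_hom_conjugate] by simp

lemma conjugate_image_generate_subset_iff:
  assumes a: "a \<in> carrier G" and S: "S \<subseteq> carrier G"
  shows "conjugate a ` generate G S \<subseteq> generate G S \<longleftrightarrow> (\<forall>s\<in>S. conjugate a s \<in> generate G S)"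
proof
  assume "\<forall>s\<in>S. conjugate a s \<in> generate G S"
  then have "generate G (conjugate a ` S) \<subseteq> generate G S"
    using S by (intro generate_subgroup_incl generate_is_subgroup) auto
  then show "conjugate a ` generate G S \<subseteq> generate G S" using a S by (simp add: conjugate_image_generate)
qed (auto intro: generate.incl)

lemma conjugate_image_eq: "H \<subseteq> carrier G \<Longrightarrow> a \<in> carrier G \<Longrightarrow> conjugate a ` H = a <# H #> inv a"
  by (auto simp: conjugate_def l_coset_def r_coset_def)

lemma mem_normalizer_iff_image:
  "H \<subseteq> carrier G \<Longrightarrow> a \<in> normalizer G H \<longleftrightarrow> a \<in> carrier G \<and> conjugate a ` H = H"
  unfolding normalizer_def stabilizer_def by (auto simp: conjugate_image_eq[symmetric])

lemma normalizer_subset: "normalizer G H \<subseteq> carrier G"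
  by (auto simp: normalizer_def stabilizer_def)

lemma subgroup_normalizer: "subgroup H G \<Longrightarrow> subgroup (normalizer G H) G"
  by (simp add: normalizer_imp_subgroup subgroup.subset)

lemma cyclic_subgroup: "x \<in> carrier G \<Longrightarrow> subgroup \<langle>x\<rangle> G"
  by (simp add: generate_is_subgroup)

lemma cyclic_self: "x \<in> \<langle>x\<rangle>"
  by (simp add: generate.incl)

lemma cyclic_subset_iff: "subgroup B G \<Longrightarrow> \<langle>x\<rangle> \<subseteq> B \<longleftrightarrow> x \<in> B"
  using generate_subgroup_incl[of "{x}" B] cyclic_self[of x] by blast

lemma cyclic_commute: "x \<in> carrier G \<Longrightarrow> a \<in> \<langle>x\<rangle> \<Longrightarrow> b \<in> \<langle>x\<rangle> \<Longrightarrow> a \<otimes> b = b \<otimes> a"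
  by (auto simp: generate_pow int_pow_mult[symmetric] add.commute)

lemma conjugate_image_cyclic:
  "a \<in> carrier G \<Longrightarrow> x \<in> carrier G \<Longrightarrow> conjugate a ` \<langle>x\<rangle> = \<langle>conjugate a x\<rangle>"
  by (simp add: conjugate_image_generate)

lemma normal_generate_of_conjugates:
  assumes S: "S \<subseteq> carrier G"
    and conj: "\<And>a s. a \<in> carrier G \<Longrightarrow> s \<in> S \<Longrightarrow> conjugate a s \<in> generate G S"
  shows "generate G S \<lhd> G"
proof (rule normal_invI[OF generate_is_subgroup[OF S]])
  fix a h assume a: "a \<in> carrier G" and h: "h \<in> generate G S"
  have "conjugate a ` generate G S \<subseteq> generate G S"
    using conjugate_image_generate_subset_iff[OF a S] conj[OF a] by blast
  then have "conjugate a h \<in> generate G S" using h by blast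
  then show "a \<otimes> h \<otimes> inv a \<in> generate G S" by (simp add: conjugate_def)
qed

lemma normal_conjugate: "H \<lhd> G \<Longrightarrow> a \<in> carrier G \<Longrightarrow> h \<in> H \<Longrightarrow> conjugate a h \<in> H"
  by (simp add: conjugate_def normal.inv_op_closed2)

context
  fixes H
  assumes H: "subgroup H G" and fin: "finite (carrier G)"
begin

interpretation H: subgroup H G by (rule H)

lemma mem_normalizer_iff: "a \<in> normalizer G H \<longleftrightarrow> a \<in> carrier G \<and> (\<forall>h\<in>H. conjugate a h \<in> H)"
proof -
  have "conjugate a ` H = H" if "a \<in> carrier G" "conjugate a ` H \<subseteq> H"
    using endo_inj_surj[OF finite_subgroup_carrier[OF H fin] that(2)] inj_on_conjugate[OF that(1) H.subset] by simp
  then show ?thesis unfolding mem_normalizer_iff_image[OF H.subset] by blast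
qed

lemma subset_normalizer: "H \<subseteq> normalizer G H"
  by (auto simp: mem_normalizer_iff conjugate_def)

lemma normal_iff_normalizer: "H \<lhd> G \<longleftrightarrow> normalizer G H = carrier G"
  using normal_conjugate normalizer_subset[of H] H
  by (auto simp: normal_inv_iff mem_normalizer_iff conjugate_def set_eq_iff)

end

lemma mem_normalizer_generate_iff:
  assumes fin: "finite (carrier G)" and S: "S \<subseteq> carrier G"
  shows "a \<in> normalizer G (generate G S) \<longleftrightarrow> a \<in> carrier G \<and> (\<forall>s\<in>S. conjugate a s \<in> generate G S)"
  using mem_normalizer_iff[OF generate_is_subgroup[OF S] fin] conjugate_image_generate_subset_iff[OF _ S]
  by blast

lemma mem_normalizer_cyclic_iff:
  "finite (carrier G) \<Longrightarrow> x \<in> carrier G \<Longrightarrow>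
    a \<in> normalizer G \<langle>x\<rangle> \<longleftrightarrow> a \<in> carrier G \<and> conjugate a x \<in> \<langle>x\<rangle>"
  using mem_normalizer_generate_iff[of "{x}"] by simp

lemma normal_cyclic_iff:
  assumes "x \<in> carrier G"
  shows "\<langle>x\<rangle> \<lhd> G \<longleftrightarrow> (\<forall>a\<in>carrier G. conjugate a x \<in> \<langle>x\<rangle>)"
  using normal_generate_of_conjugates[of "{x}"] normal_conjugate[of "\<langle>x\<rangle>"] assms cyclic_self by blast

lemma mem_cyclic_iff_nat_pow:
  "finite (carrier G) \<Longrightarrow> x \<in> carrier G \<Longrightarrow> z \<in> \<langle>x\<rangle> \<longleftrightarrow> (\<exists>n::nat. z = x [^] n)"
  by (auto simp: generate_pow_on_finite_carrier)

abbreviation index :: "'a set \<Rightarrow> nat" where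
  "index H \<equiv> card (rcosets H)"

lemma finite_subgroups: "finite (carrier G) \<Longrightarrow> finite {H. subgroup H G}"
  by (auto intro!: finite_subset[of _ "Pow (carrier G)"] dest: subgroup.subset)

lemma card_subgroup_dvd:
  assumes "subgroup A G" "subgroup B G" "A \<subseteq> B"
  shows "card A dvd card B"
proof -
  have "subgroup A (G\<lparr>carrier := B\<rparr>)" using assms by (intro subgroup_incl)
  then have "card (rcosets\<^bsub>G\<lparr>carrier := B\<rparr>\<^esub> A) * card A = card B"
    using group.lagrange[OF subgroup_imp_group[OF assms(2)]] by (simp add: order_def)
  then show ?thesis by (metis dvd_triv_right)
qed

lemma ord_dvd_card_subgroup:
  assumes "subgroup B G" "z \<in> B"
  shows "ord z dvd card B"
proof -
  have "z \<in> carrier G" using assms by (rule subgroup.mem_carrier)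
  then show ?thesis
    using card_subgroup_dvd[OF cyclic_subgroup assms(1)] cyclic_subset_iff[OF assms(1)] assms(2)
    by (simp add: generate_pow_card)
qed

lemma index_normalizer_cases:
  assumes fin: "finite (carrier G)" and H: "subgroup H G"
  obtains m where "m \<ge> 1" "card (normalizer G H) = m * card H"
    "card (carrier G - normalizer G H) = (index (normalizer G H) - 1) * m * card H"
proof -
  let ?N = "normalizer G H"
  have N: "subgroup ?N G" by (rule subgroup_normalizer[OF H])
  obtain m where m: "card ?N = m * card H"
    using card_subgroup_dvd[OF H N subset_normalizer[OF H fin]] by (metis dvdE mult.commute)
  moreover have "m \<ge> 1" using m card_subgroup_pos[OF N fin] by (cases m) auto
  moreover have "card (carrier G - ?N) = (index ?N - 1) * m * card H"
    using card_Diff_subset[OF finite_subgroup_carrier[OF N fin] normalizer_subset] lagrange[OF N] m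
    by (simp add: order_def diff_mult_distrib mult.assoc)
  ultimately show ?thesis using that by blast
qed

lemma index_normalizer_ge_2:
  assumes fin: "finite (carrier G)" and H: "subgroup H G" and nonnormal: "\<not> H \<lhd> G"
  shows "index (normalizer G H) \<ge> 2"
proof -
  let ?N = "normalizer G H"
  have N: "subgroup ?N G" by (rule subgroup_normalizer[OF H])
  have "?N \<subset> carrier G" using nonnormal normal_iff_normalizer[OF H fin] normalizer_subset by blast
  then have "card ?N < index ?N * card ?N"
    using psubset_card_mono[OF fin] lagrange[OF N] by (simp add: order_def)
  then show ?thesis by (cases "index ?N"; cases "index ?N - 1") auto
qed

end

section \<open>Subgroups of large transversal probability\<close>

context group
begin

definition nontrivial_double_cosets :: "'a set \<Rightarrow> 'a set set" where
  "nontrivial_double_cosets H = {D\<in>double_cosets H. coset_count H D \<noteq> 1}"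

context
  fixes H
  assumes H: "subgroup H G" and fin: "finite (carrier G)"
begin

lemma coset_count_eq_1_iff:
  assumes g: "g \<in> carrier G"
  shows "coset_count H (double_coset H g) = 1 \<longleftrightarrow> g \<in> normalizer G H"
proof -
  have sub: "H \<subseteq> carrier G" by (rule subgroup.subset[OF H])
  have finH: "finite H" by (rule finite_subgroup_carrier[OF H fin])
  have "coset_count H (double_coset H g) = 1 \<longleftrightarrow> card (H \<inter> conjugate g ` H) = card H"
    using coset_count_double_coset[OF H fin g] card_subgroup_pos[OF H fin] by auto
  also have "\<dots> \<longleftrightarrow> H \<inter> conjugate g ` H = H"
    using card_subset_eq[OF finH Int_lower1] by auto
  also have "\<dots> \<longleftrightarrow> conjugate g ` H = H"
    using card_subset_eq[of "conjugate g ` H" H] finH card_conjugate_image[OF g sub] by auto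
  also have "\<dots> \<longleftrightarrow> g \<in> normalizer G H" using mem_normalizer_iff_image[OF sub] g by simp
  finally show ?thesis .
qed

lemma Union_nontrivial_double_cosets: "\<Union>(nontrivial_double_cosets H) = carrier G - normalizer G H"
proof (intro equalityI subsetI)
  fix x assume "x \<in> \<Union>(nontrivial_double_cosets H)"
  then obtain D where D: "D \<in> double_cosets H" "x \<in> D" "coset_count H D \<noteq> 1"
    by (auto simp: nontrivial_double_cosets_def)
  moreover have "x \<in> carrier G" using D partition_onD1[OF partition_on_double_cosets[OF H]] by blast
  ultimately show "x \<in> carrier G - normalizer G H"
    using double_cosets_mem_eq[OF H D(1,2)] coset_count_eq_1_iff[of x] by simp
next
  fix x assume x: "x \<in> carrier G - normalizer G H"
  then have "double_coset H x \<in> nontrivial_double_cosets H"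
    using coset_count_eq_1_iff[of x] by (simp add: nontrivial_double_cosets_def double_cosets_def)
  then show "x \<in> \<Union>(nontrivial_double_cosets H)" using double_coset_self[OF H, of x] x by blast
qed

lemma finite_nontrivial_double_cosets: "finite (nontrivial_double_cosets H)"
  using finite_double_cosets[OF H fin] by (simp add: nontrivial_double_cosets_def)

lemma coset_count_ge_2: "D \<in> nontrivial_double_cosets H \<Longrightarrow> coset_count H D \<ge> 2"
  using coset_count_pos[OF H fin, of D] by (auto simp: nontrivial_double_cosets_def)

lemma card_Diff_normalizer:
  "card (carrier G - normalizer G H) = (\<Sum>D\<in>nontrivial_double_cosets H. coset_count H D) * card H"
  using card_UN_double_cosets[OF H fin, of "nontrivial_double_cosets H"]
  by (simp add: Union_nontrivial_double_cosets) (simp add: nontrivial_double_cosets_def)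

lemma transversal_prob_eq_prod_nontrivial:
  "transversal_prob G H = (\<Prod>D\<in>nontrivial_double_cosets H. fact_ratio (coset_count H D))"
  unfolding transversal_prob_eq_prod[OF H fin]
  using finite_double_cosets[OF H fin] fact_ratio_small(1)
  by (intro prod.mono_neutral_right) (auto simp: nontrivial_double_cosets_def)

lemma transversal_prob_le_prod:
  assumes S: "S \<subseteq> nontrivial_double_cosets H"
  shows "transversal_prob G H \<le> (\<Prod>D\<in>S. fact_ratio (coset_count H D))"
proof -
  have "transversal_prob G H = (\<Prod>D\<in>nontrivial_double_cosets H - S. fact_ratio (coset_count H D)) *
      (\<Prod>D\<in>S. fact_ratio (coset_count H D))"
    unfolding transversal_prob_eq_prod_nontrivial
    by (rule prod.subset_diff[OF S finite_nontrivial_double_cosets])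
  also have "\<dots> \<le> 1 * (\<Prod>D\<in>S. fact_ratio (coset_count H D))"
    by (intro mult_right_mono prod_le_1 prod_nonneg) (auto simp: fact_ratio_le_one fact_ratio_pos less_imp_le)
  finally show ?thesis by simp
qed

lemma transversal_prob_normal:
  assumes "H \<lhd> G"
  shows "transversal_prob G H = 1"
proof -
  have "nontrivial_double_cosets H = {}"
    using Union_nontrivial_double_cosets normal_iff_normalizer[OF H fin] assms
      partition_onD3[OF partition_on_double_cosets[OF H]] by (auto simp: nontrivial_double_cosets_def)
  then show ?thesis by (simp add: transversal_prob_eq_prod_nontrivial)
qed

context
  assumes P: "transversal_prob G H > 4 / 81"
begin

lemma coset_count_less_5:
  assumes "D \<in> nontrivial_double_cosets H"
  shows "coset_count H D < 5"
proof (rule ccontr)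
  assume "\<not> coset_count H D < 5"
  then have "fact_ratio (coset_count H D) \<le> 24/625" using fact_ratio_antimono[of 5] fact_ratio_small by simp
  then show False using P transversal_prob_le_prod[of "{D}"] assms by simp
qed

lemma card_nontrivial_double_cosets_le: "card (nontrivial_double_cosets H) \<le> 4"
proof (rule ccontr)
  assume many: "\<not> card (nontrivial_double_cosets H) \<le> 4"
  have "transversal_prob G H \<le> (\<Prod>D\<in>nontrivial_double_cosets H. 1/2)"
    unfolding transversal_prob_eq_prod_nontrivial
    using fact_ratio_antimono[OF coset_count_ge_2] fact_ratio_small(2)
    by (intro prod_mono) (auto simp: fact_ratio_pos less_imp_le)
  also have "\<dots> = (1/2) ^ card (nontrivial_double_cosets H)" by simp
  also have "\<dots> \<le> (1/2) ^ 5" using many by (intro power_decreasing) auto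
  finally show False using P by (simp add: power_divide)
qed

lemma coset_count_prime_power:
  assumes p: "prime p" and card: "card H = p ^ e" and D: "D \<in> nontrivial_double_cosets H"
  shows "p = 3 \<and> coset_count H D = 3 \<or> p = 2 \<and> coset_count H D \<in> {2, 4}"
proof -
  obtain i where i: "coset_count H D = p ^ i"
    using coset_count_dvd[OF H fin, of D] divides_primepow_nat[OF p] D card
    by (auto simp: nontrivial_double_cosets_def)
  moreover have "coset_count H D \<in> {2, 3, 4}"
    using coset_count_ge_2[OF D] coset_count_less_5[OF D] by auto
  moreover have "p dvd p ^ i" using i coset_count_ge_2[OF D] by (cases i) auto
  ultimately have "p dvd 2 \<and> coset_count H D = 2 \<or> p dvd 3 \<and> coset_count H D = 3 \<or>
      p dvd 2 ^ 2 \<and> coset_count H D = 4" by auto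
  then show ?thesis using p prime_dvd_power[OF p, of 2 2] primes_dvd_imp_eq[OF p] by auto
qed

text \<open>If some double coset has \<open>k \<noteq> 2\<close>, it is the only nontrivial one because \<open>3!/3\<^sup>3 \<cdot> 3!/3\<^sup>3 = 4/81\<close> and
  \<open>4!/4\<^sup>4 \<cdot> 2!/2\<^sup>2 < 4/81\<close>.\<close>

lemma nontrivial_double_cosets_unique:
  assumes p: "prime p" "card H = p ^ e"
    and D: "D \<in> nontrivial_double_cosets H" "coset_count H D \<noteq> 2" and E: "E \<in> nontrivial_double_cosets H"
  shows "E = D"
proof (rule ccontr)
  assume "E \<noteq> D"
  then have "4/81 < fact_ratio (coset_count H D) * fact_ratio (coset_count H E)"
    using P transversal_prob_le_prod[of "{D, E}"] D E by simp
  moreover have "fact_ratio (coset_count H E) \<le> fact_ratio 2"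
    by (rule fact_ratio_antimono[OF coset_count_ge_2[OF E]])
  moreover have "coset_count H D = 3 \<and> coset_count H E = 3 \<or> coset_count H D = 4"
    using coset_count_prime_power[OF p D(1)] coset_count_prime_power[OF p E] D(2) by auto
  ultimately show False by (auto simp: fact_ratio_small)
qed

lemma nontrivial_double_cosets_cases:
  assumes p: "prime p" "card H = p ^ e" and nonnormal: "\<not> H \<lhd> G"
  obtains
    (single) g k where "g \<in> carrier G" "carrier G - normalizer G H = double_coset H g"
      "card (carrier G - normalizer G H) = k * card H" "p = 3 \<and> k = 3 \<or> p = 2 \<and> k = 4"
  | (pairs) a where "p = 2" "a \<in> {1..4}" "card (carrier G - normalizer G H) = 2 * a * card H"
      "\<And>g. g \<in> carrier G - normalizer G H \<Longrightarrow> 2 * card (H \<inter> conjugate g ` H) = card H"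
proof (cases "\<exists>D\<in>nontrivial_double_cosets H. coset_count H D \<noteq> 2")
  case True
  then obtain D where D: "D \<in> nontrivial_double_cosets H" "coset_count H D \<noteq> 2" by blast
  then have "nontrivial_double_cosets H = {D}" using nontrivial_double_cosets_unique[OF p D] by blast
  moreover obtain g where "g \<in> carrier G" "D = double_coset H g"
    using D by (auto simp: nontrivial_double_cosets_def double_cosets_def)
  ultimately show ?thesis
    using single[of g "coset_count H D"] Union_nontrivial_double_cosets card_Diff_normalizer
      coset_count_prime_power[OF p D(1)] D(2) by auto
next
  case False
  have "nontrivial_double_cosets H \<noteq> {}"
    using Union_nontrivial_double_cosets nonnormal normal_iff_normalizer[OF H fin] normalizer_subset by auto
  then have card: "card (nontrivial_double_cosets H) \<in> {1..4}"
    using card_nontrivial_double_cosets_le finite_nontrivial_double_cosets by (simp add: Suc_leI card_gt_0_iff)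
  then obtain D where D: "D \<in> nontrivial_double_cosets H" by fastforce
  show ?thesis
  proof (rule pairs[OF _ card])
    show "p = 2" using coset_count_prime_power[OF p D] False D by auto
    show "card (carrier G - normalizer G H) = 2 * card (nontrivial_double_cosets H) * card H"
      using card_Diff_normalizer False by simp
    fix g assume g: "g \<in> carrier G - normalizer G H"
    then have "double_coset H g \<in> nontrivial_double_cosets H"
      using coset_count_eq_1_iff[of g] by (simp add: nontrivial_double_cosets_def double_cosets_def)
    then show "2 * card (H \<inter> conjugate g ` H) = card H"
      using False coset_count_double_coset[OF H fin, of g] g by simp
  qed
qed

lemma card_Diff_normalizer_le_2_group:
  assumes "card H = 2 ^ e"
  shows "card (carrier G - normalizer G H) \<le> 8 * card H"
proof (cases "H \<lhd> G")
  case True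
  then show ?thesis using normal_iff_normalizer[OF H fin] by simp
next
  case False
  from nontrivial_double_cosets_cases[OF two_is_prime_nat assms False] show ?thesis
    by cases auto
qed

end

end

end

section \<open>The derived subgroup\<close>

definition metabelian :: "('a, 'b) monoid_scheme \<Rightarrow> bool" where
  "metabelian G \<longleftrightarrow> derived G (derived G (carrier G)) = {\<one>\<^bsub>G\<^esub>}"

lemma (in group_hom) hom_conjugate:
  "a \<in> carrier G \<Longrightarrow> x \<in> carrier G \<Longrightarrow> h (G.conjugate a x) = H.conjugate (h a) (h x)"
  by (simp add: G.conjugate_def H.conjugate_def)

context group
begin

abbreviation derived_subgroup :: "'a set" where
  "derived_subgroup \<equiv> derived G (carrier G)"

lemma derived_subgroup_carrier: "c \<in> derived_subgroup \<Longrightarrow> c \<in> carrier G"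
  using derived_in_carrier[of "carrier G"] by blast

lemma commutator_mem_derived: "a \<in> B \<Longrightarrow> b \<in> B \<Longrightarrow> a \<otimes> b \<otimes> inv a \<otimes> inv b \<in> derived G B"
  by (auto simp: derived_def intro!: generate.incl)

lemma commutator_eq_one_iff:
  assumes "a \<in> carrier G" "b \<in> carrier G"
  shows "a \<otimes> b \<otimes> inv a \<otimes> inv b = \<one> \<longleftrightarrow> a \<otimes> b = b \<otimes> a"
proof -
  have "a \<otimes> b \<otimes> inv a \<otimes> inv b = (a \<otimes> b) \<otimes> inv (b \<otimes> a)" using assms by (simp add: group_word_simps)
  then show ?thesis using assms inv_solve_right'[of \<one> "a \<otimes> b" "b \<otimes> a"] by auto
qed

lemma derived_eq_one_iff:
  assumes B: "B \<subseteq> carrier G"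
  shows "derived G B = {\<one>} \<longleftrightarrow> (\<forall>a\<in>B. \<forall>b\<in>B. a \<otimes> b = b \<otimes> a)"
proof
  assume triv: "derived G B = {\<one>}"
  show "\<forall>a\<in>B. \<forall>b\<in>B. a \<otimes> b = b \<otimes> a"
  proof (intro ballI)
    fix a b assume ab: "a \<in> B" "b \<in> B"
    then have "a \<otimes> b \<otimes> inv a \<otimes> inv b = \<one>" using commutator_mem_derived[OF ab] triv by simp
    then show "a \<otimes> b = b \<otimes> a" using commutator_eq_one_iff[of a b] ab B by blast
  qed
next
  assume comm: "\<forall>a\<in>B. \<forall>b\<in>B. a \<otimes> b = b \<otimes> a"
  have "derived_set G B \<subseteq> {\<one>}"
  proof clarify
    fix a b assume "a \<in> B" "b \<in> B"
    then show "a \<otimes> b \<otimes> inv a \<otimes> inv b = \<one>" using commutator_eq_one_iff[of a b] comm B by blast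
  qed
  then have "derived G B \<subseteq> {\<one>}" unfolding derived_def by (rule generate_subgroup_incl[OF _ triv_subgroup])
  then show "derived G B = {\<one>}" using generate.one[of G "derived_set G B"] unfolding derived_def by blast
qed

lemma comm_group_iff_derived: "comm_group G \<longleftrightarrow> derived_subgroup = {\<one>}"
proof
  assume "comm_group G"
  then show "derived_subgroup = {\<one>}" by (rule comm_group.derived_eq_singleton) simp
next
  assume "derived_subgroup = {\<one>}"
  then show "comm_group G" using derived_eq_one_iff[of "carrier G"] by (intro group_comm_groupI) simp
qed

lemma metabelian_iff: "metabelian G \<longleftrightarrow> (\<forall>c\<in>derived_subgroup. \<forall>d\<in>derived_subgroup. c \<otimes> d = d \<otimes> c)"
  unfolding metabelian_def by (rule derived_eq_one_iff) (simp add: derived_in_carrier)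

lemma comm_group_imp_metabelian: "comm_group G \<Longrightarrow> metabelian G"
  by (meson comm_group.axioms(1) comm_monoid.m_comm derived_subgroup_carrier metabelian_iff)

lemma centralizer_subgroup: "x \<in> carrier G \<Longrightarrow> subgroup {c\<in>carrier G. conjugate c x = x} G"
proof
  fix c assume x: "x \<in> carrier G" and "c \<in> {c\<in>carrier G. conjugate c x = x}"
  then show "inv c \<in> {c\<in>carrier G. conjugate c x = x}" using conjugate_eq_iff[of c x x] by simp
qed (auto simp: conjugate_conjugate[symmetric])

lemma generate_centralizes:
  assumes S: "S \<subseteq> carrier G" and x: "x \<in> carrier G" and comm: "\<And>s. s \<in> S \<Longrightarrow> s \<otimes> x = x \<otimes> s"
    and c: "c \<in> generate G S"
  shows "c \<otimes> x = x \<otimes> c"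
proof -
  have "S \<subseteq> {c\<in>carrier G. conjugate c x = x}"
    using S comm conjugate_eq_self_iff[OF _ x] by auto
  then have "generate G S \<subseteq> {c\<in>carrier G. conjugate c x = x}"
    by (rule generate_subgroup_incl[OF _ centralizer_subgroup[OF x]])
  then show ?thesis using c conjugate_eq_self_iff[OF _ x, of c] by auto
qed

lemma generate_commute:
  assumes S: "S \<subseteq> carrier G" and comm: "\<And>s t. s \<in> S \<Longrightarrow> t \<in> S \<Longrightarrow> s \<otimes> t = t \<otimes> s"
    and a: "a \<in> generate G S" and b: "b \<in> generate G S"
  shows "a \<otimes> b = b \<otimes> a"
proof (rule generate_centralizes[OF S generate_in_carrier[OF S b] _ a])
  fix s assume s: "s \<in> S"
  then have "b \<otimes> s = s \<otimes> b" using S comm by (intro generate_centralizes[OF S _ _ b]) auto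
  then show "s \<otimes> b = b \<otimes> s" by simp
qed

lemma comm_group_of_commuting_generators:
  assumes "S \<subseteq> carrier G" "generate G S = carrier G"
    and "\<And>s t. s \<in> S \<Longrightarrow> t \<in> S \<Longrightarrow> s \<otimes> t = t \<otimes> s"
  shows "comm_group G"
  using generate_commute[OF assms(1,3)] assms(2) by (intro group_comm_groupI) simp

lemma r_coset_group_hom: "A \<lhd> G \<Longrightarrow> group_hom G (G Mod A) (\<lambda>a. A #> a)"
  by (intro group_hom.intro group_hom_axioms.intro is_group normal.factorgroup_is_group normal.r_coset_hom_Mod)

lemma derived_subset_of_commuting_generators:
  assumes A: "A \<lhd> G" and S: "S \<subseteq> carrier G" "generate G S = carrier G"
    and comm: "\<And>s t. s \<in> S \<Longrightarrow> t \<in> S \<Longrightarrow> A #> (s \<otimes> t) = A #> (t \<otimes> s)"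
  shows "derived_subgroup \<subseteq> A"
proof (rule derived_minimal[OF A])
  interpret q: group_hom G "G Mod A" "\<lambda>a. A #> a" by (rule r_coset_group_hom[OF A])
  let ?S = "(\<lambda>a. A #> a) ` S"
  show "comm_group (G Mod A)"
  proof (rule q.H.comm_group_of_commuting_generators)
    show "?S \<subseteq> carrier (G Mod A)" using S(1) by auto
    show "generate (G Mod A) ?S = carrier (G Mod A)"
      using q.generate_img[OF S(1)] S(2) by (simp add: carrier_FactGroup)
    fix X Y assume "X \<in> ?S" "Y \<in> ?S"
    then obtain s t where "s \<in> S" "t \<in> S" "X = A #> s" "Y = A #> t" by blast
    then show "X \<otimes>\<^bsub>G Mod A\<^esub> Y = Y \<otimes>\<^bsub>G Mod A\<^esub> X"
      using comm[of s t] S(1) q.hom_mult[of s t] q.hom_mult[of t s] by auto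
  qed
qed

lemma comm_group_of_order_less_5:
  assumes fin: "finite (carrier G)" and small: "order G < 5"
  shows "comm_group G"
proof (rule group_comm_groupI, rule ccontr)
  fix a b assume ab: "a \<in> carrier G" "b \<in> carrier G" and n: "a \<otimes> b \<noteq> b \<otimes> a"
  then have "a \<noteq> \<one>" "b \<noteq> \<one>" "a \<noteq> b" by auto
  moreover from this have "a \<otimes> b \<noteq> a" "a \<otimes> b \<noteq> b" "b \<otimes> a \<noteq> a" "b \<otimes> a \<noteq> b"
    using ab by (auto simp: r_cancel_one l_cancel_one)
  moreover have "a \<otimes> b \<noteq> \<one>" "b \<otimes> a \<noteq> \<one>" using n ab by (metis inv_comm)+
  ultimately have "card {\<one>, a, b, a \<otimes> b, b \<otimes> a} = 5" using n by auto
  moreover have "card {\<one>, a, b, a \<otimes> b, b \<otimes> a} \<le> order G"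
    unfolding order_def using ab fin by (intro card_mono) auto
  ultimately show False using small by simp
qed

lemma derived_subset_of_index_less_5:
  assumes fin: "finite (carrier G)" and A: "A \<lhd> G" and small: "index A < 5"
  shows "derived_subgroup \<subseteq> A"
proof (rule derived_minimal[OF A])
  interpret q: group_hom G "G Mod A" "\<lambda>a. A #> a" by (rule r_coset_group_hom[OF A])
  show "comm_group (G Mod A)"
    by (rule q.H.comm_group_of_order_less_5)
      (use fin small in \<open>simp_all add: carrier_FactGroup order_def RCOSETS_def UNION_singleton_eq_range\<close>)
qed

lemma mult_mem_of_index_2:
  assumes N: "subgroup N G" and index_2: "index N = 2"
    and a: "a \<in> carrier G" "a \<notin> N" and b: "b \<in> carrier G" "b \<notin> N"
  shows "a \<otimes> b \<in> N"
proof (rule ccontr)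
  assume n: "a \<otimes> b \<notin> N"
  interpret subgroup N G by fact
  have bi: "inv b \<notin> N" using b m_inv_closed[of "inv b"] by auto
  have "N #> a \<noteq> N #> inv b" using r_coset_eq_iff[OF N, of a "inv b"] a b n by simp
  moreover have "N #> a \<noteq> N #> \<one>" using r_coset_eq_iff[OF N, of a \<one>] a by simp
  moreover have "N #> inv b \<noteq> N #> \<one>" using r_coset_eq_iff[OF N, of "inv b" \<one>] b bi by simp
  ultimately have "card {N #> \<one>, N #> a, N #> inv b} = 3" by auto
  moreover have "{N #> \<one>, N #> a, N #> inv b} \<subseteq> rcosets N" using a b by (auto simp: RCOSETS_def)
  moreover have "finite (rcosets N)" using index_2 by (intro card_ge_0_finite) simp
  ultimately have "3 \<le> index N" using card_mono by metis
  then show False using index_2 by simp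
qed

lemma normal_of_index_2:
  assumes N: "subgroup N G" and index_2: "index N = 2"
  shows "N \<lhd> G"
proof (rule normal_invI[OF N])
  interpret subgroup N G by fact
  fix a n assume a: "a \<in> carrier G" and n: "n \<in> N"
  show "a \<otimes> n \<otimes> inv a \<in> N"
  proof (cases "a \<in> N")
    case False
    have "a \<otimes> n \<notin> N"
    proof
      assume "a \<otimes> n \<in> N"
      then have "a \<otimes> n \<otimes> inv n \<in> N" using n by blast
      then show False using False a n by (simp add: m_assoc)
    qed
    moreover have "inv a \<notin> N" using False a m_inv_closed[of "inv a"] by auto
    ultimately show ?thesis using mult_mem_of_index_2[OF N index_2] a n by simp
  qed (use n in simp)
qed

lemma derived_centralizes:
  assumes x: "x \<in> carrier G"
    and comm: "\<And>a b. a \<in> carrier G \<Longrightarrow> b \<in> carrier G \<Longrightarrow> conjugate (a \<otimes> b) x = conjugate (b \<otimes> a) x"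
    and c: "c \<in> derived_subgroup"
  shows "conjugate c x = x"
proof -
  have "derived_set G (carrier G) \<subseteq> {c\<in>carrier G. conjugate c x = x}"
  proof clarify
    fix a b assume ab: "a \<in> carrier G" "b \<in> carrier G"
    have "conjugate (a \<otimes> b \<otimes> inv a \<otimes> inv b) x = conjugate (a \<otimes> b) (conjugate (inv a \<otimes> inv b) x)"
      using ab x by (simp add: conjugate_conjugate m_assoc)
    also have "conjugate (inv a \<otimes> inv b) x = conjugate (inv b \<otimes> inv a) x" using comm ab by simp
    also have "conjugate (a \<otimes> b) \<dots> = x" using ab x by (simp add: conjugate_conjugate group_word_simps)
    finally show "a \<otimes> b \<otimes> inv a \<otimes> inv b \<in> carrier G \<and> conjugate (a \<otimes> b \<otimes> inv a \<otimes> inv b) x = x"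
      using ab by simp
  qed
  then have "derived_subgroup \<subseteq> {c\<in>carrier G. conjugate c x = x}"
    unfolding derived_def by (rule generate_subgroup_incl[OF _ centralizer_subgroup[OF x]])
  then show ?thesis using c by blast
qed

lemma derived_centralizes_normal_cyclic:
  assumes fin: "finite (carrier G)" and x: "x \<in> carrier G"
    and normal: "\<langle>x\<rangle> \<lhd> G" and c: "c \<in> derived_subgroup"
  shows "conjugate c x = x"
proof (rule derived_centralizes[OF x _ c])
  fix a b assume ab: "a \<in> carrier G" "b \<in> carrier G"
  obtain i j :: nat where i: "conjugate a x = x [^] i" and j: "conjugate b x = x [^] j"
    using normal_cyclic_iff[OF x] normal mem_cyclic_iff_nat_pow[OF fin x] ab by metis
  have "conjugate (a \<otimes> b) x = x [^] (i * j)"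
    using ab x i j conjugate_conjugate[of a b x] by (simp add: conjugate_nat_pow nat_pow_pow)
  moreover have "conjugate (b \<otimes> a) x = x [^] (j * i)"
    using ab x i j conjugate_conjugate[of b a x] by (simp add: conjugate_nat_pow nat_pow_pow)
  ultimately show "conjugate (a \<otimes> b) x = conjugate (b \<otimes> a) x" by (simp add: mult.commute)
qed

lemma derived_centralizes_normal_cyclic_mod:
  assumes fin: "finite (carrier G)" and T: "T \<lhd> G" and x: "x \<in> carrier G"
    and normal: "\<And>a. a \<in> carrier G \<Longrightarrow> \<exists>z\<in>\<langle>x\<rangle>. T #> conjugate a x = T #> z"
    and c: "c \<in> derived_subgroup"
  shows "T #> conjugate c x = T #> x"
proof -
  let ?Q = "G Mod T"
  interpret q: group_hom G ?Q "\<lambda>a. T #> a" by (rule r_coset_group_hom[OF T])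
  have cyc: "generate ?Q {T #> x} = (\<lambda>a. T #> a) ` \<langle>x\<rangle>" using q.generate_img[of "{x}"] x by simp
  have "q.H.conjugate X (T #> x) \<in> generate ?Q {T #> x}" if X: "X \<in> carrier ?Q" for X
  proof -
    obtain a where "a \<in> carrier G" "X = T #> a" using X by (auto simp: carrier_FactGroup)
    then show ?thesis using normal[of a] x by (auto simp: cyc q.hom_conjugate[symmetric])
  qed
  then have "generate ?Q {T #> x} \<lhd> ?Q" using q.H.normal_cyclic_iff x by simp
  moreover have "T #> c \<in> derived ?Q (carrier ?Q)"
    using q.derived_img[of "carrier G"] c by (simp add: carrier_FactGroup)
  moreover have "finite (carrier ?Q)" using fin by (simp add: carrier_FactGroup)
  ultimately have "q.H.conjugate (T #> c) (T #> x) = T #> x"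
    using q.H.derived_centralizes_normal_cyclic x by simp
  then show ?thesis using x derived_subgroup_carrier[OF c] by (simp add: q.hom_conjugate)
qed

end

section \<open>Elements and subgroups of prime power order\<close>

context group
begin

lemma prime_not_dvd_relative_index:
  assumes fin: "finite (carrier G)" and B: "subgroup B G" and C: "subgroup C G" "C \<subseteq> B"
    and q: "prime q" and elements: "\<And>y e. y \<in> B \<Longrightarrow> ord y = q ^ e \<Longrightarrow> y \<in> C"
    and card: "card B = r * card C"
  shows "\<not> q dvd r"
proof
  assume "q dvd r"
  define a where "a = multiplicity q (card B)"
  obtain m where m: "card B = q ^ a * m" "\<not> q dvd m"
    using multiplicity_decompose'[of "card B" q] card_subgroup_pos[OF B fin] q
    unfolding a_def by (metis not_prime_unit less_not_refl)
  have finB: "finite B" by (rule finite_subgroup_carrier[OF B fin])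
  interpret B: group "G\<lparr>carrier := B\<rparr>" by (rule subgroup_imp_group[OF B])
  obtain Q where Q: "subgroup Q (G\<lparr>carrier := B\<rparr>)" "card Q = q ^ a"
    using sylow_thm[OF q B.is_group, of a m] m finB by (auto simp: order_def)
  have QG: "subgroup Q G" using incl_subgroup[OF B Q(1)] .
  have "Q \<subseteq> C"
  proof
    fix y assume y: "y \<in> Q"
    then obtain e where "ord y = q ^ e"
      using ord_dvd_card_subgroup[OF QG y] Q(2) divides_primepow_nat[OF q] by auto
    then show "y \<in> C" using elements y subgroup.subset[OF Q(1)] by auto
  qed
  then have "q ^ a dvd card C" using card_subgroup_dvd[OF QG C(1)] Q(2) by simp
  then have "q ^ a * q dvd q ^ a * m"
    using mult_dvd_mono[OF _ \<open>q dvd r\<close>, of "q ^ a" "card C"] m(1) card by (simp add: mult.commute)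
  then show False using m(2) q by (simp add: prime_gt_0_nat)
qed

lemma subgroup_eq_of_prime_power_elements:
  assumes fin: "finite (carrier G)" and B: "subgroup B G" and C: "subgroup C G" "C \<subseteq> B"
    and elements: "\<And>y q e. y \<in> B \<Longrightarrow> prime (q::nat) \<Longrightarrow> ord y = q ^ e \<Longrightarrow> y \<in> C"
  shows "C = B"
proof -
  obtain r where r: "card B = r * card C"
    using card_subgroup_dvd[OF C(1) B C(2)] by (metis dvdE mult.commute)
  have "\<not> q dvd r" if "prime q" for q
    by (rule prime_not_dvd_relative_index[OF fin B C that _ r]) (rule elements[OF _ that])
  then have "r = 1" using prime_factor_nat by blast
  then show ?thesis using card_subset_eq[OF finite_subgroup_carrier[OF B fin] C(2)] r by simp
qed

lemma metabelianI_prime_power: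
  assumes fin: "finite (carrier G)"
    and centralized: "\<And>x q e c. x \<in> derived_subgroup \<Longrightarrow> prime (q::nat) \<Longrightarrow> ord x = q ^ e \<Longrightarrow>
      c \<in> derived_subgroup \<Longrightarrow> conjugate c x = x"
  shows "metabelian G"
proof -
  have D: "subgroup derived_subgroup G" by (rule derived_is_subgroup) simp
  interpret D: subgroup derived_subgroup G by (rule D)
  have "c \<otimes> d = d \<otimes> c" if cd: "c \<in> derived_subgroup" "d \<in> derived_subgroup" for c d
  proof -
    let ?C = "derived_subgroup \<inter> {c \<in> carrier G. conjugate c d = d}"
    have "?C = derived_subgroup"
    proof (rule subgroup_eq_of_prime_power_elements[OF fin D])
      show "subgroup ?C G" using cd by (intro subgroups_Inter_pair D centralizer_subgroup) simp
      fix y q e assume y: "y \<in> derived_subgroup" "prime (q::nat)" "ord y = q ^ e"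
      then have "conjugate d y = y" using centralized cd(2) by blast
      then show "y \<in> ?C" using y(1) cd(2) by (simp add: conjugate_eq_self_iff)
    qed blast
    then have "conjugate c d = d" using cd(1) by blast
    then show ?thesis using cd by (simp add: conjugate_eq_self_iff)
  qed
  then show ?thesis by (simp add: metabelian_iff)
qed

end

lemma (in group_action) prime_power_group_fixed_point:
  assumes p: "prime p" and order: "order G = p ^ n" and fin: "finite E" and dvd: "p dvd card E"
    and x: "x \<in> E" "\<And>g. g \<in> carrier G \<Longrightarrow> \<phi> g x = x"
  shows "\<exists>y\<in>E. y \<noteq> x \<and> (\<forall>g\<in>carrier G. \<phi> g y = y)"
proof (rule ccontr)
  assume none: "\<not> ?thesis"
  interpret group G using group_hom by (rule group_hom.axioms(1))
  have orbit_x: "orbit G \<phi> x = {x}" using x(2) orbit_refl[OF x(1)] by (auto simp: orbit_def)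
  have "p dvd card \<Omega>" if orbit: "\<Omega> \<in> orbits G E \<phi> - {{x}}" for \<Omega>
  proof -
    obtain y where y: "y \<in> E" "\<Omega> = orbit G \<phi> y" using orbit by (auto simp: orbits_def)
    have "card \<Omega> dvd p ^ n" using orbit_stabilizer_theorem[OF y(1)] y order by (metis dvd_triv_left)
    then obtain i where i: "card \<Omega> = p ^ i" using divides_primepow_nat[OF p] by blast
    have "i \<noteq> 0"
    proof
      assume "i = 0"
      then obtain z where "\<Omega> = {z}" using i by (auto simp: card_1_singleton_iff)
      then have "orbit G \<phi> y = {y}" using y(2) orbit_refl[OF y(1)] by simp
      moreover have "\<phi> g y \<in> orbit G \<phi> y" if "g \<in> carrier G" for g
        using that unfolding orbit_def by blast
      ultimately have "\<forall>g\<in>carrier G. \<phi> g y = y" by auto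
      then have "y = x" using none y(1) by blast
      then show False using orbit y(2) orbit_x by simp
    qed
    then show ?thesis using i by simp
  qed
  moreover have "\<Union>(orbits G E \<phi> - {{x}}) = E - {x}"
  proof -
    have "{x} \<in> orbits G E \<phi>" using orbit_x x(1) by (auto simp: orbits_def)
    then show ?thesis using orbits_coverture disjoint_union by blast
  qed
  ultimately have "p dvd card (E - {x})"
    using dvd_partition[of "orbits G E \<phi> - {{x}}" p] fin disjoint_union by (metis DiffD1 finite_Diff)
  then have "p dvd card E - 1" using x fin by simp
  moreover have "card E - (card E - 1) = 1" using x(1) fin card_gt_0_iff[of E] by fastforce
  ultimately have "p dvd 1" using dvd_diff_nat[OF dvd, of "card E - 1"] by simp
  then show False using p by simp
qed

lemma (in normal) card_Union_factgroup_subgroup: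
  assumes S: "subgroup S (G Mod H)"
  shows "card (\<Union>S) = card S * card H"
proof -
  have US: "subgroup (\<Union>S) G" by (rule factgroup_subgroup_union_subgroup[OF S])
  have "H \<in> S" using subgroup.one_closed[OF S] by simp
  then have "subgroup H (G\<lparr>carrier := \<Union>S\<rparr>)" using US by (intro subgroup_incl subgroup_axioms) auto
  then have "card (rcosets\<^bsub>G\<lparr>carrier := \<Union>S\<rparr>\<^esub> H) * card H = card (\<Union>S)"
    using group.lagrange[OF subgroup_imp_group[OF US]] by (simp add: order_def)
  then show ?thesis by (simp flip: factgroup_subgroup_union_factor[OF S])
qed

context group
begin

lemma prime_power_group_central_element:
  assumes p: "prime p" and order: "order G = p ^ n" "n > 0"
  obtains z where "z \<in> carrier G" "ord z = p" "\<And>a. a \<in> carrier G \<Longrightarrow> conjugate a z = z"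
proof -
  let ?\<phi> = "\<lambda>g. \<lambda>h\<in>carrier G. g \<otimes> h \<otimes> inv g"
  interpret conj: group_action G "carrier G" ?\<phi> by (rule action_by_conjugation)
  have "finite (carrier G)"
    using order p by (intro card_ge_0_finite) (simp add: order_def[symmetric] prime_gt_0_nat)
  moreover have "p dvd card (carrier G)" using order by (simp add: order_def)
  ultimately obtain y where y: "y \<in> carrier G" "y \<noteq> \<one>" "\<And>a. a \<in> carrier G \<Longrightarrow> conjugate a y = y"
    using conj.prime_power_group_fixed_point[OF p order(1), of \<one>] by (auto simp: conjugate_def)
  obtain i where i: "ord y = p ^ i"
    using ord_dvd_group_order[OF y(1)] order(1) divides_primepow_nat[OF p] by auto
  have "i \<noteq> 0" using i y ord_eq_1[OF y(1)] by (auto intro: ccontr)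
  then have "ord (y [^] (p ^ (i - 1))) = p ^ i div p ^ (i - 1)"
    using ord_pow[OF y(1), of "p ^ (i - 1)"] i p by (simp add: le_imp_power_dvd prime_gt_0_nat)
  also have "\<dots> = p" using \<open>i \<noteq> 0\<close> p by (simp add: prime_gt_0_nat flip: power_diff)
  finally show ?thesis using that[of "y [^] (p ^ (i - 1))"] y by (simp add: conjugate_nat_pow)
qed

lemma prime_power_group_normal_subgroup:
  assumes p: "prime p" and order: "order G = p ^ n" and "k \<le> n"
  shows "\<exists>A. A \<lhd> G \<and> card A = p ^ k"
  using \<open>k \<le> n\<close>
proof (induction k)
  case 0
  show ?case using one_is_normal by force
next
  case (Suc k)
  then obtain A where A: "A \<lhd> G" "card A = p ^ k" by auto
  interpret A: normal A G by (rule A)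
  interpret Q: group "G Mod A" by (rule A.factorgroup_is_group)
  have "index A * p ^ k = p ^ (n - k) * p ^ k"
    using lagrange[OF A.subgroup_axioms] A(2) order Suc.prems by (simp flip: power_add)
  then have orderQ: "order (G Mod A) = p ^ (n - k)"
    using p by (simp add: order_def FactGroup_def prime_gt_0_nat)
  obtain Z where Z: "Z \<in> carrier (G Mod A)" "Q.ord Z = p"
      "\<And>X. X \<in> carrier (G Mod A) \<Longrightarrow> Q.conjugate X Z = Z"
    using Q.prime_power_group_central_element[OF p orderQ] Suc.prems by auto
  let ?S = "generate (G Mod A) {Z}"
  have S: "?S \<lhd> G Mod A" using Q.normal_cyclic_iff[OF Z(1)] Z(3) Q.cyclic_self by simp
  then have "card (\<Union>?S) = p ^ Suc k"
    using A.card_Union_factgroup_subgroup[OF normal_imp_subgroup[OF S]] A(2) Z Q.generate_pow_card by simp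
  then show ?case using A.factgroup_subgroup_union_normal[OF S] by blast
qed

lemma card_derived_subgroup_2_group_le:
  assumes order: "order G = 2 ^ n" and n: "n \<ge> 2"
  shows "4 * card derived_subgroup \<le> order G"
proof -
  have fin: "finite (carrier G)" using order by (intro card_ge_0_finite) (simp add: order_def[symmetric])
  obtain A where A: "A \<lhd> G" "card A = 2 ^ (n - 2)"
    using prime_power_group_normal_subgroup[OF two_is_prime_nat order, of "n - 2"] by auto
  have "(2::nat) ^ n = 2 ^ 2 * 2 ^ (n - 2)" using n by (simp only: power_add[symmetric] le_add_diff_inverse)
  then have four: "order G = 4 * card A" using order A(2) by simp
  then have "index A = 4" using lagrange[OF normal_imp_subgroup[OF A(1)]] A(2) by simp
  then have "derived_subgroup \<subseteq> A" using derived_subset_of_index_less_5[OF fin A(1)] by simp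
  then have "card derived_subgroup \<le> card A"
    using finite_subgroup_carrier[OF normal_imp_subgroup[OF A(1)] fin] by (rule card_mono[rotated])
  then show ?thesis using four by simp
qed

lemma card_conjugate_subgroups:
  assumes fin: "finite (carrier G)" and H: "subgroup H G"
  shows "card ((\<lambda>a. conjugate a ` H) ` carrier G) = index (normalizer G H)"
proof -
  let ?\<phi> = "\<lambda>g. \<lambda>H\<in>{H. H \<subseteq> carrier G}. g <# H #> inv g"
  interpret conj: group_action G "{H. H \<subseteq> carrier G}" ?\<phi> by (rule action_by_conjugation_on_power_set)
  have sub: "H \<subseteq> carrier G" by (rule subgroup.subset[OF H])
  have N: "subgroup (normalizer G H) G" by (rule subgroup_normalizer[OF H])
  have "orbit G ?\<phi> H = (\<lambda>a. conjugate a ` H) ` carrier G"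
    using sub by (auto simp: orbit_def conjugate_image_eq[OF sub])
  then have "card ((\<lambda>a. conjugate a ` H) ` carrier G) * card (normalizer G H) = order G"
    using conj.orbit_stabilizer_theorem[of H] sub by (simp add: normalizer_def)
  also have "\<dots> = index (normalizer G H) * card (normalizer G H)" using lagrange[OF N] by simp
  finally show ?thesis using card_subgroup_pos[OF N fin] by (metis mult_right_cancel less_not_refl)
qed

lemma Int_eq_of_prime_relative_index:
  assumes fin: "finite (carrier G)" and C: "subgroup C G" and D: "subgroup D G" and K: "subgroup K G"
    and sub: "K \<subseteq> C \<inter> D" and p: "prime p" "card C = p * card K" "card D = p * card K" and ne: "C \<noteq> D"
  shows "C \<inter> D = K"
proof -
  have I: "subgroup (C \<inter> D) G" using C D by (rule subgroups_Inter_pair)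
  obtain j where j: "card (C \<inter> D) = card K * j" using card_subgroup_dvd[OF K I sub] by (rule dvdE)
  have "card K * j dvd card K * p" using card_subgroup_dvd[OF I C] j p(2) by (simp add: mult.commute)
  then have "j dvd p" using card_subgroup_pos[OF K fin] by simp
  moreover have "j \<noteq> p"
  proof
    assume "j = p"
    then have "C \<inter> D = C" "C \<inter> D = D"
      using card_subset_eq[OF finite_subgroup_carrier[OF C fin] Int_lower1, of D]
        card_subset_eq[OF finite_subgroup_carrier[OF D fin] Int_lower2, of C] j p by (simp_all add: mult.commute)
    then show False using ne by simp
  qed
  ultimately have "j = 1" using p(1) by (auto simp: prime_nat_iff)
  then show ?thesis using card_subset_eq[OF finite_subgroup_carrier[OF I fin] sub] j by simp
qed

lemma card_Union_conjugates_Diff: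
  assumes fin: "finite (carrier G)" and H: "subgroup H G" and K: "K \<lhd> G" "K \<subseteq> H"
    and p: "prime p" "card H = p * card K"
  shows "card ((\<Union>a\<in>carrier G. conjugate a ` H) - K) = index (normalizer G H) * (p - 1) * card K"
proof -
  define \<C> where "\<C> = (\<lambda>a. conjugate a ` H) ` carrier G"
  have Ksg: "subgroup K G" by (rule normal_imp_subgroup[OF K(1)])
  have sub: "subgroup C G" "card C = p * card K" "K \<subseteq> C" if C: "C \<in> \<C>" for C
  proof -
    obtain a where a: "a \<in> carrier G" "C = conjugate a ` H" using C by (auto simp: \<C>_def)
    show "subgroup C G" using a subgroup_conjugate_image[OF _ H] by simp
    show "card C = p * card K" using a card_conjugate_image[OF _ subgroup.subset[OF H]] p(2) by simp
    have "k = conjugate a (conjugate (inv a) k)" if "k \<in> K" for k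
      using a(1) that Ksg by (simp add: conjugate_conjugate subgroup.mem_carrier)
    then show "K \<subseteq> C" using normal_conjugate[OF K(1), of "inv a"] a K(2) by blast
  qed
  have meet: "C \<inter> D = K" if "C \<in> \<C>" "D \<in> \<C>" "C \<noteq> D" for C D
    using that sub by (intro Int_eq_of_prime_relative_index[OF fin _ _ Ksg _ p(1)]) simp_all
  have "(\<Union>a\<in>carrier G. conjugate a ` H) - K = (\<Union>C\<in>\<C>. C - K)" by (auto simp: \<C>_def)
  also have "card \<dots> = (\<Sum>C\<in>\<C>. card (C - K))"
  proof (rule card_UN_disjoint)
    show "finite \<C>" using fin by (simp add: \<C>_def)
    show "\<forall>C\<in>\<C>. finite (C - K)" using finite_subgroup_carrier[OF sub(1) fin] by blast
    show "\<forall>C\<in>\<C>. \<forall>D\<in>\<C>. C \<noteq> D \<longrightarrow> (C - K) \<inter> (D - K) = {}" using meet by blast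
  qed
  also have "\<dots> = (\<Sum>C\<in>\<C>. (p - 1) * card K)"
    using sub(2,3) finite_subgroup_carrier[OF Ksg fin]
    by (intro sum.cong) (auto simp: card_Diff_subset diff_mult_distrib)
  finally show ?thesis using card_conjugate_subgroups[OF fin H] by (simp add: \<C>_def)
qed

end

section \<open>Criteria for an abelian derived subgroup\<close>

context group
begin

lemma normal_of_normalizing_generators:
  assumes fin: "finite (carrier G)" and A: "subgroup A G"
    and S: "generate G S = carrier G" "S \<subseteq> normalizer G A"
  shows "A \<lhd> G"
  using generate_subgroup_incl[OF S(2) subgroup_normalizer[OF A]] S(1) normalizer_subset[of A]
    normal_iff_normalizer[OF A fin] by auto

lemma normal_conjugate_image:
  assumes N: "N \<lhd> G" and a: "a \<in> carrier G"
  shows "conjugate a ` N = N"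
proof
  show "N \<subseteq> conjugate a ` N"
  proof
    fix n assume n: "n \<in> N"
    then have "n = conjugate a (conjugate (inv a) n)"
      using a normal_imp_subgroup[OF N] by (simp add: conjugate_conjugate subgroup.mem_carrier)
    then show "n \<in> conjugate a ` N" using normal_conjugate[OF N _ n, of "inv a"] a by blast
  qed
qed (use normal_conjugate[OF N a] in blast)

lemma conjugate_image_normalizer:
  assumes H: "H \<subseteq> carrier G" and a: "a \<in> carrier G" and n: "n \<in> normalizer G H"
  shows "conjugate a n \<in> normalizer G (conjugate a ` H)"
proof -
  have nc: "n \<in> carrier G" "conjugate n ` H = H" using n mem_normalizer_iff_image[OF H] by auto
  have "conjugate (conjugate a n) (conjugate a h) = conjugate a (conjugate n h)" if "h \<in> H" for h
    using a nc(1) subsetD[OF H that] by (simp add: conjugate_conjugate) (simp add: conjugate_def group_word_simps)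
  then have "conjugate (conjugate a n) ` conjugate a ` H = conjugate a ` conjugate n ` H"
    by (auto simp: image_image)
  moreover have "conjugate a ` H \<subseteq> carrier G" using H a by auto
  ultimately show ?thesis using mem_normalizer_iff_image[of "conjugate a ` H"] a nc by simp
qed

lemma commutator_mem_Int:
  assumes A: "subgroup A G" "a \<in> A" "a \<in> normalizer G B" and B: "subgroup B G" "b \<in> B" "b \<in> normalizer G A"
  shows "inv a \<otimes> conjugate b a \<in> A \<inter> B"
proof
  interpret A: subgroup A G by (rule A)
  interpret B: subgroup B G by (rule B)
  have "conjugate b a \<in> A" using mem_normalizer_iff_image[OF A.subset] A B by blast
  then show "inv a \<otimes> conjugate b a \<in> A" using A by simp
  have "inv a \<in> normalizer G B" using subgroup.m_inv_closed[OF subgroup_normalizer[OF B(1)] A(3)] .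
  then have "conjugate (inv a) b \<in> B" using mem_normalizer_iff_image[OF B.subset] B by blast
  moreover have "inv a \<otimes> conjugate b a = conjugate (inv a) b \<otimes> inv b"
    using A B by (simp add: conjugate_def group_word_simps)
  ultimately show "inv a \<otimes> conjugate b a \<in> B" using B by simp
qed

lemma normal_factor_of_double_coset:
  assumes H: "subgroup H G" and N: "N \<lhd> G" and g: "g \<in> carrier G" "g \<notin> N"
    and outside: "carrier G - N = double_coset H g" and n: "n \<in> N"
  obtains a b where "a \<in> H" "b \<in> conjugate g ` H" "n = a \<otimes> b"
proof -
  interpret H: subgroup H G by (rule H)
  interpret N: normal N G by (rule N)
  have "n \<otimes> g \<notin> N"
  proof
    assume "n \<otimes> g \<in> N"
    then have "inv n \<otimes> (n \<otimes> g) \<in> N" using n by blast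
    then show False using g n by (simp add: inv_mult_cancel)
  qed
  then have "n \<otimes> g \<in> double_coset H g" unfolding outside[symmetric] using n g by simp
  then obtain h h' where h: "h \<in> H" "h' \<in> H" "n \<otimes> g = h \<otimes> g \<otimes> h'" by (auto simp: double_coset_def)
  have "n = n \<otimes> g \<otimes> inv g" using n g by (simp add: m_assoc)
  also have "\<dots> = h \<otimes> conjugate g h'" unfolding h(3) using h g by (simp add: conjugate_def m_assoc)
  finally show ?thesis using that h by blast
qed

lemma generate_of_double_coset:
  assumes x: "x \<in> carrier G" and N: "N \<lhd> G" and g: "g \<in> carrier G" "g \<notin> N"
    and outside: "carrier G - N = double_coset \<langle>x\<rangle> g"
  shows "generate G {x, g} = carrier G"
proof
  interpret B: subgroup "generate G {x, g}" G using x g by (intro generate_is_subgroup) auto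
  have gB: "g \<in> generate G {x, g}" and XB: "\<langle>x\<rangle> \<subseteq> generate G {x, g}"
    using cyclic_subset_iff[OF B.subgroup_axioms, of x] by (auto intro: generate.incl)
  then have YB: "conjugate g ` \<langle>x\<rangle> \<subseteq> generate G {x, g}" by (auto simp: conjugate_def)
  show "carrier G \<subseteq> generate G {x, g}"
  proof
    fix a assume "a \<in> carrier G"
    then consider "a \<in> N" | "a \<in> double_coset \<langle>x\<rangle> g" using outside by blast
    then show "a \<in> generate G {x, g}"
    proof cases
      case 1
      then obtain h k where "h \<in> \<langle>x\<rangle>" "k \<in> conjugate g ` \<langle>x\<rangle>" "a = h \<otimes> k"
        by (rule normal_factor_of_double_coset[OF cyclic_subgroup[OF x] N g outside])
      then show ?thesis using XB YB by auto
    next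
      case 2
      then show ?thesis using XB gB by (auto simp: double_coset_def)
    qed
  qed
qed (use x g generate_incl in auto)

end

text \<open>Modulo \<open>K\<close> the elements \<open>x\<close> and \<open>y\<close> commute and are swapped by \<open>g\<close>, so \<open>G'\<close> lies in
  \<open>\<langle>x\<^sup>-\<^sup>1y\<rangle>K\<close>, which is abelian because \<open>x\<close> and \<open>y\<close> centralise \<open>K\<close>.\<close>

locale swapped_generators = group +
  fixes x y g
  assumes fin: "finite (carrier G)" and x: "x \<in> carrier G" and g: "g \<in> carrier G"
    and y_eq: "y = conjugate g x" and gen: "generate G {x, g} = carrier G"
    and comm: "inv x \<otimes> conjugate y x \<in> \<langle>x\<rangle> \<inter> \<langle>y\<rangle>"
    and swap: "inv x \<otimes> conjugate g y \<in> \<langle>x\<rangle> \<inter> \<langle>y\<rangle>"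
begin

abbreviation K :: "'a set" where
  "K \<equiv> \<langle>x\<rangle> \<inter> \<langle>y\<rangle>"

abbreviation A :: "'a set" where
  "A \<equiv> generate G (insert (inv x \<otimes> y) K)"

lemma y: "y \<in> carrier G"
  using x g by (simp add: y_eq)

lemma K_carrier: "k \<in> K \<Longrightarrow> k \<in> carrier G"
  using subgroup.mem_carrier[OF cyclic_subgroup[OF x]] by blast

lemma generators_carrier: "insert (inv x \<otimes> y) K \<subseteq> carrier G"
  using x y K_carrier by blast

lemma generators_subset: "K \<subseteq> A" "inv x \<otimes> y \<in> A"
  by (auto intro: generate.incl)

lemma subgroup_A: "subgroup A G"
  by (rule generate_is_subgroup[OF generators_carrier])

lemma K_centralizes:
  assumes k: "k \<in> K"
  shows "conjugate k x = x" "conjugate k (inv x \<otimes> y) = inv x \<otimes> y"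
proof -
  show kx: "conjugate k x = x"
    using k cyclic_commute[OF x _ cyclic_self] K_carrier[OF k] x by (simp add: conjugate_eq_self_iff)
  have "conjugate k y = y"
    using k cyclic_commute[OF y _ cyclic_self] K_carrier[OF k] y by (simp add: conjugate_eq_self_iff)
  then show "conjugate k (inv x \<otimes> y) = inv x \<otimes> y"
    using kx K_carrier[OF k] x y by (simp add: conjugate_mult conjugate_inv)
qed

lemma conjugate_g_K:
  assumes k: "k \<in> K"
  shows "conjugate g k \<in> K"
proof -
  interpret X: subgroup "\<langle>x\<rangle>" G by (rule cyclic_subgroup[OF x])
  have "x \<otimes> (inv x \<otimes> conjugate g y) \<in> \<langle>x\<rangle>" using swap cyclic_self[of x] by blast
  then have "conjugate g y \<in> \<langle>x\<rangle>" using x y g by (simp add: mult_inv_cancel)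
  then have "conjugate g ` \<langle>y\<rangle> \<subseteq> \<langle>x\<rangle>"
    using conjugate_image_cyclic[OF g y] cyclic_subset_iff[OF X.subgroup_axioms] by simp
  moreover have "conjugate g ` \<langle>x\<rangle> = \<langle>y\<rangle>" using conjugate_image_cyclic[OF g x] by (simp add: y_eq)
  ultimately show ?thesis using k by blast
qed

lemma normal_A: "A \<lhd> G"
proof (rule normal_of_normalizing_generators[OF fin subgroup_A gen])
  interpret A: subgroup A G by (rule subgroup_A)
  have "conjugate x (inv x \<otimes> y) = inv (inv x \<otimes> conjugate y x) \<otimes> (inv x \<otimes> y)"
    using x y by (simp add: conjugate_def group_word_simps)
  also have "\<dots> \<in> A" using comm generators_subset by blast
  finally have "conjugate x (inv x \<otimes> y) \<in> A" .
  moreover have "conjugate x k = k" if "k \<in> K" for k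
    using K_centralizes(1)[OF that] K_carrier[OF that] x by (simp add: conjugate_eq_self_iff)
  ultimately have "x \<in> normalizer G A"
    unfolding mem_normalizer_generate_iff[OF fin generators_carrier] using x generators_subset(1) by auto
  moreover have "conjugate g (inv x \<otimes> y) = inv (inv x \<otimes> y) \<otimes> (inv x \<otimes> conjugate g y)"
    using x y g by (simp add: conjugate_mult conjugate_inv y_eq[symmetric] group_word_simps)
  then have "conjugate g (inv x \<otimes> y) \<in> A" using swap generators_subset by auto
  then have "g \<in> normalizer G A"
    unfolding mem_normalizer_generate_iff[OF fin generators_carrier]
    using g conjugate_g_K generators_subset(1) by blast
  ultimately show "{x, g} \<subseteq> normalizer G A" by blast
qed

theorem metabelian: "metabelian G"
proof -
  have "(x \<otimes> g) \<otimes> inv (g \<otimes> x) = conjugate x (inv (inv x \<otimes> y))"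
    using x g by (simp add: y_eq conjugate_def group_word_simps)
  also have "\<dots> \<in> A"
    using normal_conjugate[OF normal_A x] subgroup.m_inv_closed[OF subgroup_A generators_subset(2)] .
  finally have "A #> (x \<otimes> g) = A #> (g \<otimes> x)" using r_coset_eq_iff[OF subgroup_A] x g by simp
  then have "derived_subgroup \<subseteq> A"
    using derived_subset_of_commuting_generators[OF normal_A _ gen] x g by auto
  moreover have "c \<otimes> d = d \<otimes> c" if cd: "c \<in> A" "d \<in> A" for c d
  proof (rule generate_commute[OF generators_carrier _ cd])
    fix s t assume st: "s \<in> insert (inv x \<otimes> y) K" "t \<in> insert (inv x \<otimes> y) K"
    have "k \<otimes> (inv x \<otimes> y) = (inv x \<otimes> y) \<otimes> k" if "k \<in> K" for k
      using K_centralizes(2)[OF that] conjugate_eq_self_iff K_carrier[OF that] generators_carrier by blast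
    then show "s \<otimes> t = t \<otimes> s" using st cyclic_commute[OF x, of s t] by auto
  qed
  ultimately show ?thesis by (auto simp: metabelian_iff)
qed

end

context group
begin

lemma metabelian_of_index_2_double_coset:
  assumes fin: "finite (carrier G)" and x: "x \<in> carrier G" and g: "g \<in> carrier G"
    and index_2: "index (normalizer G \<langle>x\<rangle>) = 2"
    and outside: "carrier G - normalizer G \<langle>x\<rangle> = double_coset \<langle>x\<rangle> g"
  shows "metabelian G"
proof -
  define N where "N = normalizer G \<langle>x\<rangle>"
  define y where "y = conjugate g x"
  note outside = outside[folded N_def] and index_2 = index_2[folded N_def]
  have X: "subgroup \<langle>x\<rangle> G" and y: "y \<in> carrier G" using cyclic_subgroup[OF x] x g by (simp_all add: y_def)
  have Y: "subgroup \<langle>y\<rangle> G" and Y_eq: "conjugate g ` \<langle>x\<rangle> = \<langle>y\<rangle>"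
    using cyclic_subgroup[OF y] conjugate_image_cyclic[OF g x] by (simp_all add: y_def)
  have subgroup_N: "subgroup N G" unfolding N_def by (rule subgroup_normalizer[OF X])
  have N: "N \<lhd> G" by (rule normal_of_index_2[OF subgroup_N index_2])
  have gN: "g \<notin> N" using outside double_coset_self[OF X g] by blast
  have XN: "\<langle>x\<rangle> \<subseteq> N" unfolding N_def by (rule subset_normalizer[OF X fin])
  have YN: "\<langle>y\<rangle> \<subseteq> N" using image_mono[OF XN, of "conjugate g"] normal_conjugate_image[OF N g] Y_eq by simp
  have "conjugate g ` N \<subseteq> normalizer G \<langle>y\<rangle>"
    using conjugate_image_normalizer[OF subgroup.subset[OF X] g] unfolding N_def Y_eq by (rule image_subsetI)
  then have N_Y: "N \<subseteq> normalizer G \<langle>y\<rangle>" using normal_conjugate_image[OF N g] by simp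
  have comm: "inv x \<otimes> conjugate b x \<in> \<langle>x\<rangle> \<inter> \<langle>y\<rangle>" if "b \<in> \<langle>y\<rangle>" for b
    using that XN YN N_Y cyclic_self[of x] unfolding N_def by (intro commutator_mem_Int X Y) auto
  have swap: "inv x \<otimes> conjugate g y \<in> \<langle>x\<rangle> \<inter> \<langle>y\<rangle>"
  proof -
    have "g \<otimes> g \<in> N" using mult_mem_of_index_2[OF subgroup_N index_2 g gN g gN] .
    then obtain a b where ab: "a \<in> \<langle>x\<rangle>" "b \<in> \<langle>y\<rangle>" "g \<otimes> g = a \<otimes> b"
      by (rule normal_factor_of_double_coset[OF X N g gN outside, unfolded Y_eq])
    have carr: "a \<in> carrier G" "b \<in> carrier G"
      using subgroup.mem_carrier[OF X ab(1)] subgroup.mem_carrier[OF Y ab(2)] by simp_all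
    let ?k = "inv x \<otimes> conjugate b x"
    have "conjugate a x = x" "conjugate a ?k = ?k"
      using cyclic_commute[OF x ab(1)] cyclic_self[of x] comm[OF ab(2)] carr x
      by (simp_all add: conjugate_eq_self_iff)
    then have "conjugate a (x \<otimes> ?k) = x \<otimes> ?k" using carr x by (simp add: conjugate_mult)
    moreover have "conjugate g y = conjugate a (x \<otimes> ?k)"
      using ab(3) carr g x by (simp add: y_def conjugate_conjugate mult_inv_cancel)
    ultimately show ?thesis using comm[OF ab(2)] x carr by (simp add: inv_mult_cancel)
  qed
  have gen: "generate G {x, g} = carrier G" by (rule generate_of_double_coset[OF x N g gN outside])
  interpret swapped_generators G x y g
    by unfold_locales (use fin x g gen comm[OF cyclic_self] swap in \<open>simp_all add: y_def\<close>)
  show ?thesis by (rule metabelian)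
qed

lemma card_prime_torsion_ge:
  assumes fin: "finite (carrier G)" and H: "subgroup H G" and p: "prime p" "card H = p"
  shows "index (normalizer G H) * (p - 1) \<le> card {z \<in> carrier G. z [^] p = \<one> \<and> z \<noteq> \<one>}"
proof -
  let ?U = "(\<Union>a\<in>carrier G. conjugate a ` H) - {\<one>}"
  have "?U \<subseteq> {z \<in> carrier G. z [^] p = \<one> \<and> z \<noteq> \<one>}"
  proof
    fix z assume "z \<in> ?U"
    then obtain a h where a: "a \<in> carrier G" and h: "h \<in> H" and z: "z = conjugate a h" "z \<noteq> \<one>" by blast
    have hc: "h \<in> carrier G" by (rule subgroup.mem_carrier[OF H h])
    have "h [^] p = \<one>" using pow_eq_id[OF hc, of p] ord_dvd_card_subgroup[OF H h] p(2) by simp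
    then show "z \<in> {z \<in> carrier G. z [^] p = \<one> \<and> z \<noteq> \<one>}"
      using a hc z by (simp flip: conjugate_nat_pow)
  qed
  then have "card ?U \<le> card {z \<in> carrier G. z [^] p = \<one> \<and> z \<noteq> \<one>}" using fin by (intro card_mono) auto
  moreover have "card ?U = index (normalizer G H) * (p - 1)"
    using card_Union_conjugates_Diff[OF fin H one_is_normal _ p(1)] p(2) subgroup.one_closed[OF H] by simp
  ultimately show ?thesis by simp
qed

lemma metabelian_of_order_12:
  assumes order: "order G = 12" and H: "subgroup H G" "card H = 3" and self: "normalizer G H = H"
  shows "metabelian G"
proof -
  have fin: "finite (carrier G)" using order by (intro card_ge_0_finite) (simp add: order_def[symmetric])
  obtain Q where Q: "subgroup Q G" "card Q = 4"
    using sylow_thm[of 2 G 2 3] order fin is_group by auto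
  define T where "T = {z \<in> carrier G. z [^] (3::nat) = \<one> \<and> z \<noteq> \<one>}"
  have card_T: "8 \<le> card T"
    using card_prime_torsion_ge[OF fin H(1), of 3] H(2) self lagrange[OF H(1)] order by (simp add: T_def)
  have Q_eq: "Q = carrier G - T"
  proof (rule card_seteq)
    show "Q \<subseteq> carrier G - T"
    proof
      fix z assume z: "z \<in> Q"
      then have zc: "z \<in> carrier G" by (rule subgroup.mem_carrier[OF Q(1)])
      have "z \<notin> T"
      proof
        assume "z \<in> T"
        then have "ord z dvd 3" "z \<noteq> \<one>" using pow_eq_id[OF zc, of 3] by (auto simp: T_def)
        moreover have "ord z dvd 4" using ord_dvd_card_subgroup[OF Q(1) z] Q(2) by simp
        ultimately have "ord z dvd 4 - 3" by (intro dvd_diff_nat)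
        then show False using ord_eq_1[OF zc] \<open>z \<noteq> \<one>\<close> by simp
      qed
      then show "z \<in> carrier G - T" using zc by blast
    qed
    show "card (carrier G - T) \<le> card Q"
      using card_T order Q(2) fin by (subst card_Diff_subset) (auto simp: T_def order_def)
  qed (use fin in simp)
  have "conjugate a q \<in> Q" if "a \<in> carrier G" "q \<in> Q" for a q
    using that by (auto simp: Q_eq T_def conjugate_eq_iff simp flip: conjugate_nat_pow)
  then have "Q \<lhd> G" by (intro normal_invI Q(1)) (simp add: conjugate_def)
  then have sub: "derived_subgroup \<subseteq> Q"
    using derived_subset_of_index_less_5[OF fin] lagrange[OF Q(1)] Q(2) order by simp
  have "comm_group (G\<lparr>carrier := Q\<rparr>)"
    using Q(2) finite_subgroup_carrier[OF Q(1) fin]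
    by (intro group.comm_group_of_order_less_5 subgroup_imp_group[OF Q(1)]) (simp_all add: order_def)
  then have "c \<otimes> d = d \<otimes> c" if "c \<in> Q" "d \<in> Q" for c d
    using comm_monoid.m_comm[OF comm_group.axioms(1), of _ c d] that by fastforce
  then show ?thesis using sub by (auto simp: metabelian_iff)
qed

end

section \<open>Cyclic 2-subgroups\<close>

context group
begin

lemma cyclic_nat_pow_coprime:
  assumes fin: "finite (carrier G)" and w: "w \<in> carrier G" and j: "coprime (ord w) j"
  shows "\<langle>w [^] j\<rangle> = \<langle>w\<rangle>"
proof (rule card_subset_eq)
  show "finite \<langle>w\<rangle>" by (rule finite_subgroup_carrier[OF cyclic_subgroup[OF w] fin])
  show "\<langle>w [^] j\<rangle> \<subseteq> \<langle>w\<rangle>"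
    using mem_cyclic_iff_nat_pow[OF fin w] by (simp add: cyclic_subset_iff[OF cyclic_subgroup[OF w]]) blast
  have "ord (w [^] j) = ord w" using ord_pow_gen[OF w, of j] j by (cases "j = 0") auto
  then show "card \<langle>w [^] j\<rangle> = card \<langle>w\<rangle>" using generate_pow_card w by simp
qed

lemma conjugate_involution_in_normal_cyclic:
  assumes fin: "finite (carrier G)" and w: "w \<in> carrier G" and normal: "\<langle>w\<rangle> \<lhd> G"
    and k: "k \<in> \<langle>w\<rangle>" "k \<otimes> k = \<one>" and a: "a \<in> carrier G"
  shows "conjugate a k = k"
proof -
  have kc: "k \<in> carrier G" using subgroup.mem_carrier[OF cyclic_subgroup[OF w] k(1)] .
  obtain m s :: nat where m: "k = w [^] m" and s: "conjugate a w = w [^] s"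
    using normal normal_cyclic_iff[OF w] mem_cyclic_iff_nat_pow[OF fin w] k(1) a by metis
  have "conjugate a k = k [^] s" using m s a w by (simp add: conjugate_nat_pow nat_pow_pow mult.commute)
  moreover have "k [^] s = \<one> \<or> k [^] s = k" using k kc by (induction s) auto
  moreover have "k = \<one>" if "conjugate a k = \<one>" using that a kc conjugate_inject[of a k \<one>] by simp
  ultimately show ?thesis using a by auto
qed

lemma derived_centralizes_involution_coset:
  assumes fin: "finite (carrier G)" and w: "w \<in> carrier G" and normal: "\<langle>w\<rangle> \<lhd> G"
    and t: "t \<in> carrier G" "t \<otimes> t = \<one>" and comm: "t \<otimes> w = w \<otimes> t"
    and coset: "\<And>a. a \<in> carrier G \<Longrightarrow> \<exists>k\<in>\<langle>w\<rangle>. conjugate a t = t \<otimes> k"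
    and c: "c \<in> derived_subgroup"
  shows "conjugate c t = t"
proof (rule derived_centralizes[OF t(1) _ c])
  have K: "subgroup \<langle>w\<rangle> G" by (rule cyclic_subgroup[OF w])
  have coset': "\<exists>k\<in>\<langle>w\<rangle>. conjugate a t = t \<otimes> k \<and> k \<otimes> k = \<one>" if a: "a \<in> carrier G" for a
  proof -
    obtain k where k: "k \<in> \<langle>w\<rangle>" "conjugate a t = t \<otimes> k" using coset[OF a] by blast
    have kc: "k \<in> carrier G" by (rule subgroup.mem_carrier[OF K k(1)])
    have "\<one> = conjugate a (t \<otimes> t)" using a t by simp
    also have "\<dots> = t \<otimes> (k \<otimes> t) \<otimes> k" using a t(1) k(2) kc by (simp add: conjugate_mult m_assoc)
    also have "k \<otimes> t = t \<otimes> k" using generate_centralizes[of "{w}" t k] w t k comm by simp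
    also have "t \<otimes> (t \<otimes> k) \<otimes> k = (t \<otimes> t) \<otimes> (k \<otimes> k)" using t(1) kc by (simp add: m_assoc)
    also have "\<dots> = k \<otimes> k" using t kc by simp
    finally have "k \<otimes> k = \<one>" by simp
    then show ?thesis using k by blast
  qed
  fix a b assume ab: "a \<in> carrier G" "b \<in> carrier G"
  obtain k where k: "k \<in> \<langle>w\<rangle>" "conjugate a t = t \<otimes> k" "k \<otimes> k = \<one>" using coset'[OF ab(1)] by blast
  obtain l where l: "l \<in> \<langle>w\<rangle>" "conjugate b t = t \<otimes> l" "l \<otimes> l = \<one>" using coset'[OF ab(2)] by blast
  have carr: "k \<in> carrier G" "l \<in> carrier G" using subgroup.mem_carrier[OF K] k l by blast+
  have "conjugate (a \<otimes> b) t = t \<otimes> k \<otimes> l"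
    using conjugate_involution_in_normal_cyclic[OF fin w normal l(1,3) ab(1)] ab t k l carr
    by (simp add: conjugate_conjugate[symmetric] conjugate_mult)
  moreover have "conjugate (b \<otimes> a) t = t \<otimes> l \<otimes> k"
    using conjugate_involution_in_normal_cyclic[OF fin w normal k(1,3) ab(2)] ab t k l carr
    by (simp add: conjugate_conjugate[symmetric] conjugate_mult)
  ultimately show "conjugate (a \<otimes> b) t = conjugate (b \<otimes> a) t"
    using cyclic_commute[OF w k(1) l(1)] t carr by (simp add: m_assoc)
qed

lemma derived_centralizes_coset_of_subset:
  assumes fin: "finite (carrier G)" and u: "u \<in> carrier G" and K: "K \<subseteq> \<langle>u\<rangle>"
    and coset: "\<And>a. a \<in> carrier G \<Longrightarrow> \<exists>k\<in>K. conjugate a u = u \<otimes> k" and c: "c \<in> derived_subgroup"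
  shows "conjugate c u = u"
proof -
  have "conjugate a u \<in> \<langle>u\<rangle>" if a: "a \<in> carrier G" for a
  proof -
    obtain k where "k \<in> K" "conjugate a u = u \<otimes> k" using coset[OF a] by blast
    then show ?thesis using K cyclic_self[of u] subgroup.m_closed[OF cyclic_subgroup[OF u]] by auto
  qed
  then have "\<langle>u\<rangle> \<lhd> G" using normal_cyclic_iff[OF u] by blast
  then show ?thesis by (rule derived_centralizes_normal_cyclic[OF fin u _ c])
qed

text \<open>The coset \<open>u\<langle>w\<rangle>\<close> contains the element \<open>t = uv\<^sup>-\<^sup>1\<close> with \<open>t\<^sup>2 = 1\<close>.\<close>

lemma derived_centralizes_coset_of_square:
  assumes fin: "finite (carrier G)" and w: "w \<in> carrier G" and normal: "\<langle>w\<rangle> \<lhd> G"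
    and u: "u \<in> carrier G" and v: "v \<in> \<langle>w\<rangle>" "u \<otimes> u = v \<otimes> v" and comm: "u \<otimes> w = w \<otimes> u"
    and coset: "\<And>a. a \<in> carrier G \<Longrightarrow> \<exists>k\<in>\<langle>w\<rangle>. conjugate a u = u \<otimes> k"
    and c: "c \<in> derived_subgroup"
  shows "conjugate c u = u"
proof -
  interpret K: subgroup "\<langle>w\<rangle>" G by (rule cyclic_subgroup[OF w])
  define t where "t = u \<otimes> inv v"
  have vc: "v \<in> carrier G" by (rule K.mem_carrier[OF v(1)])
  have t: "t \<in> carrier G" and u_eq: "u = t \<otimes> v" using u vc by (simp_all add: t_def m_assoc)
  have u_commutes: "k \<otimes> u = u \<otimes> k" if "k \<in> \<langle>w\<rangle>" for k
    using generate_centralizes[of "{w}" u k] w u comm that by simp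
  have "conjugate c t = t"
  proof (rule derived_centralizes_involution_coset[OF fin w normal t _ _ _ c])
    have "t \<otimes> t = u \<otimes> (inv v \<otimes> u) \<otimes> inv v" using u vc by (simp add: t_def m_assoc)
    also have "\<dots> = (u \<otimes> u) \<otimes> inv v \<otimes> inv v" using u_commutes[of "inv v"] u v(1) vc by (simp add: m_assoc)
    finally show "t \<otimes> t = \<one>" using v(2) vc by (simp add: group_word_simps)
    show "t \<otimes> w = w \<otimes> t"
      using comm cyclic_commute[OF w, of "inv v" w] cyclic_self[of w] u v(1) vc w
      by (simp add: t_def m_assoc) (simp add: m_assoc[symmetric])
    fix a assume a: "a \<in> carrier G"
    obtain k where k: "k \<in> \<langle>w\<rangle>" "conjugate a u = u \<otimes> k" using coset[OF a] by blast
    have av: "conjugate a v \<in> \<langle>w\<rangle>" by (rule normal_conjugate[OF normal a v(1)])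
    have "conjugate a t = t \<otimes> (v \<otimes> k \<otimes> inv (conjugate a v))"
      using a u vc k av by (simp add: t_def conjugate_mult conjugate_inv group_word_simps)
    then show "\<exists>k\<in>\<langle>w\<rangle>. conjugate a t = t \<otimes> k" using v(1) k av by blast
  qed
  moreover have "conjugate c v = v"
    using derived_centralizes_normal_cyclic[OF fin w normal c] derived_subgroup_carrier[OF c] w v(1)
      mem_cyclic_iff_nat_pow[OF fin w] by (auto simp: conjugate_nat_pow)
  ultimately show ?thesis using derived_subgroup_carrier[OF c] t vc u_eq by (simp add: conjugate_mult)
qed

lemma derived_centralizes_coset:
  assumes fin: "finite (carrier G)" and w: "w \<in> carrier G" "ord w = 2 ^ f" and normal: "\<langle>w\<rangle> \<lhd> G"
    and u: "u \<in> carrier G" "u \<otimes> u \<in> \<langle>w\<rangle>" and comm: "u \<otimes> w = w \<otimes> u"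
    and coset: "\<And>a. a \<in> carrier G \<Longrightarrow> \<exists>k\<in>\<langle>w\<rangle>. conjugate a u = u \<otimes> k"
    and c: "c \<in> derived_subgroup"
  shows "conjugate c u = u"
proof -
  obtain j :: nat where j: "u \<otimes> u = w [^] j" using u(2) mem_cyclic_iff_nat_pow[OF fin w(1)] by blast
  show ?thesis
  proof (cases "odd j")
    case True
    have "w [^] j \<in> \<langle>u\<rangle>"
      using subgroup.m_closed[OF cyclic_subgroup[OF u(1)] cyclic_self cyclic_self] j by simp
    then have "\<langle>w [^] j\<rangle> \<subseteq> \<langle>u\<rangle>" using cyclic_subset_iff[OF cyclic_subgroup[OF u(1)]] by blast
    then have "\<langle>w\<rangle> \<subseteq> \<langle>u\<rangle>" using cyclic_nat_pow_coprime[OF fin w(1), of j] True w(2) by simp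
    then show ?thesis by (rule derived_centralizes_coset_of_subset[OF fin u(1) _ coset c])
  next
    case False
    then obtain i where "j = i + i" by (metis evenE mult_2)
    then have "u \<otimes> u = w [^] i \<otimes> w [^] i" using j w(1) by (simp add: nat_pow_mult)
    moreover have "w [^] i \<in> \<langle>w\<rangle>" using mem_cyclic_iff_nat_pow[OF fin w(1)] by blast
    ultimately show ?thesis
      by (intro derived_centralizes_coset_of_square[OF fin w(1) normal u(1) _ _ comm coset c])
  qed
qed

lemma mult_mem_of_relative_index_2:
  assumes A: "subgroup A G" and B: "subgroup B G" "B \<subseteq> A" and card: "card A = 2 * card B" "card B > 0"
    and a: "a \<in> A" "a \<notin> B" and b: "b \<in> A" "b \<notin> B"
  shows "a \<otimes> b \<in> B"
proof -
  interpret A: group "G\<lparr>carrier := A\<rparr>" by (rule subgroup_imp_group[OF A])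
  have BA: "subgroup B (G\<lparr>carrier := A\<rparr>)" by (rule subgroup_incl[OF B(1) A B(2)])
  have "A.index B = 2" using A.lagrange[OF BA] card by (simp add: order_def)
  then show ?thesis using A.mult_mem_of_index_2[OF BA, of a b] a b by simp
qed

lemma square_mem_of_relative_index_2:
  assumes A: "subgroup A G" and B: "subgroup B G" "B \<subseteq> A" and card: "card A = 2 * card B" "card B > 0"
    and a: "a \<in> A"
  shows "a \<otimes> a \<in> B"
  using mult_mem_of_relative_index_2[OF A B card a _ a] subgroup.m_closed[OF B(1), of a a] by blast

text \<open>Both \<open>H\<close> and \<open>gHg\<^sup>-\<^sup>1\<close> contain \<open>H \<inter> gHg\<^sup>-\<^sup>1\<close> with index 2, so \<open>x\<^sup>2\<close> and its conjugate both generate it.\<close>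

lemma normal_square_cyclic:
  assumes fin: "finite (carrier G)" and x: "x \<in> carrier G" and even: "even (ord x)"
    and meet: "\<And>g. g \<in> carrier G - normalizer G \<langle>x\<rangle> \<Longrightarrow>
      2 * card (\<langle>x\<rangle> \<inter> conjugate g ` \<langle>x\<rangle>) = card \<langle>x\<rangle>"
  shows "card \<langle>x\<rangle> = 2 * card \<langle>x \<otimes> x\<rangle>" "\<langle>x \<otimes> x\<rangle> \<lhd> G"
proof -
  interpret X: subgroup "\<langle>x\<rangle>" G by (rule cyclic_subgroup[OF x])
  interpret K: subgroup "\<langle>x \<otimes> x\<rangle>" G using x by (intro cyclic_subgroup) simp
  have sq: "x [^] (2::nat) = x \<otimes> x" using x by (simp add: numeral_2_eq_2)
  have "ord (x \<otimes> x) = ord x div 2" using ord_pow[OF x, of 2] even sq by simp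
  then show card: "card \<langle>x\<rangle> = 2 * card \<langle>x \<otimes> x\<rangle>" using even generate_pow_card x by simp
  have "conjugate g (x \<otimes> x) \<in> \<langle>x \<otimes> x\<rangle>" if g: "g \<in> carrier G" for g
  proof (cases "g \<in> normalizer G \<langle>x\<rangle>")
    case True
    then obtain i :: nat where "conjugate g x = x [^] i"
      using mem_normalizer_cyclic_iff[OF fin x] mem_cyclic_iff_nat_pow[OF fin x] by blast
    then have "conjugate g (x \<otimes> x) = (x \<otimes> x) [^] i" using g x by (simp add: conjugate_mult pow_mult_distrib)
    then show ?thesis using mem_cyclic_iff_nat_pow[OF fin, of "x \<otimes> x"] x by blast
  next
    case False
    let ?Y = "conjugate g ` \<langle>x\<rangle>"
    let ?B = "\<langle>x\<rangle> \<inter> ?Y"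
    have Y: "subgroup ?Y G" by (rule subgroup_conjugate_image[OF g X.subgroup_axioms])
    have B: "subgroup ?B G" by (rule subgroups_Inter_pair[OF X.subgroup_axioms Y])
    have cardB: "card \<langle>x\<rangle> = 2 * card ?B" "card ?Y = 2 * card ?B" "card ?B > 0"
      using meet[of g] False g card_conjugate_image[OF g X.subset] card_subgroup_pos[OF B fin] by simp_all
    have "x \<otimes> x \<in> ?B"
      using square_mem_of_relative_index_2[OF X.subgroup_axioms B _ cardB(1,3)] cyclic_self[of x] by blast
    then have "\<langle>x \<otimes> x\<rangle> = ?B"
      using cyclic_subset_iff[OF B] card cardB(1) finite_subgroup_carrier[OF B fin] by (intro card_subset_eq) auto
    moreover have "conjugate g x \<otimes> conjugate g x \<in> ?B"
      using square_mem_of_relative_index_2[OF Y B _ cardB(2,3)] cyclic_self[of x] by blast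
    ultimately show ?thesis using g x by (simp add: conjugate_mult)
  qed
  then show "\<langle>x \<otimes> x\<rangle> \<lhd> G" using normal_cyclic_iff[of "x \<otimes> x"] x by simp
qed

text \<open>The conjugates of \<open>\<langle>x\<rangle>\<close> would need \<open>4|K|\<close> elements of \<open>G' - K\<close>, where \<open>K = \<langle>x\<^sup>2\<rangle>\<close>, but \<open>|G'| \<le> 4|K|\<close>.\<close>

lemma index_normalizer_ne_4:
  assumes fin: "finite (carrier G)" and x: "x \<in> derived_subgroup" "ord x = 2 ^ e"
    and K: "\<langle>x \<otimes> x\<rangle> \<lhd> G" "card \<langle>x\<rangle> = 2 * card \<langle>x \<otimes> x\<rangle>"
    and N: "card (normalizer G \<langle>x\<rangle>) = 2 * card \<langle>x\<rangle>"
  shows "index (normalizer G \<langle>x\<rangle>) \<noteq> 4"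
proof
  assume index_4: "index (normalizer G \<langle>x\<rangle>) = 4"
  let ?K = "\<langle>x \<otimes> x\<rangle>" and ?U = "\<Union>a\<in>carrier G. conjugate a ` \<langle>x\<rangle>"
  have xc: "x \<in> carrier G" by (rule derived_subgroup_carrier[OF x(1)])
  have X: "subgroup \<langle>x\<rangle> G" by (rule cyclic_subgroup[OF xc])
  have D: "subgroup derived_subgroup G" by (rule derived_is_subgroup) simp
  have order: "order G = 4 * (2 * card \<langle>x\<rangle>)"
    using lagrange[OF subgroup_normalizer[OF X]] index_4 N by simp
  then have "order G = 2 ^ (e + 3)" using generate_pow_card[OF xc] x(2) by (simp add: power_add)
  then have "4 * card derived_subgroup \<le> order G" by (rule card_derived_subgroup_2_group_le) simp
  then have card_D: "card derived_subgroup \<le> 4 * card ?K" using order K(2) by simp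
  have sub: "?K \<subseteq> \<langle>x\<rangle>"
    using cyclic_subset_iff[OF X] subgroup.m_closed[OF X cyclic_self cyclic_self] by blast
  have XD: "\<langle>x\<rangle> \<subseteq> derived_subgroup" using cyclic_subset_iff[OF D] x(1) by blast
  then have "?U \<subseteq> derived_subgroup" using normal_conjugate[OF derived_self_is_normal] by blast
  then have "card (?U - ?K) \<le> card (derived_subgroup - ?K)"
    using finite_subgroup_carrier[OF D fin] by (intro card_mono) auto
  also have "\<dots> = card derived_subgroup - card ?K"
    using sub XD finite_subgroup_carrier[OF normal_imp_subgroup[OF K(1)] fin] by (intro card_Diff_subset) auto
  also have "\<dots> \<le> 3 * card ?K" using card_D by simp
  finally have "card (?U - ?K) \<le> 3 * card ?K" .
  moreover have "card (?U - ?K) = 4 * card ?K"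
    using card_Union_conjugates_Diff[OF fin X K(1) sub two_is_prime_nat K(2)] index_4 by simp
  ultimately show False using card_subgroup_pos[OF normal_imp_subgroup[OF K(1)] fin] by simp
qed

lemma r_coset_mult_cong:
  assumes K: "K \<lhd> G" and carr: "a \<in> carrier G" "a' \<in> carrier G" "b \<in> carrier G" "b' \<in> carrier G"
    and eq: "K #> a = K #> a'" "K #> b = K #> b'"
  shows "K #> (a \<otimes> b) = K #> (a' \<otimes> b')"
  using normal.rcos_sum[OF K carr(1,3)] normal.rcos_sum[OF K carr(2,4)] eq by simp

lemma r_coset_conjugate_cong:
  assumes K: "K \<lhd> G" and carr: "a \<in> carrier G" "z \<in> carrier G" "z' \<in> carrier G"
    and eq: "K #> z = K #> z'"
  shows "K #> conjugate a z = K #> conjugate a z'"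
  unfolding conjugate_def using carr eq by (intro r_coset_mult_cong[OF K]) simp_all

end

locale conjugate_pair = group +
  fixes x g
  assumes fin: "finite (carrier G)" and x: "x \<in> carrier G"
    and normal_square: "\<langle>x \<otimes> x\<rangle> \<lhd> G" and card_square: "card \<langle>x\<rangle> = 2 * card \<langle>x \<otimes> x\<rangle>"
    and index_2: "index (normalizer G \<langle>x\<rangle>) = 2" and g: "g \<in> carrier G" "g \<notin> normalizer G \<langle>x\<rangle>"
begin

abbreviation K :: "'a set" where
  "K \<equiv> \<langle>x \<otimes> x\<rangle>"

abbreviation N :: "'a set" where
  "N \<equiv> normalizer G \<langle>x\<rangle>"

abbreviation y :: 'a where
  "y \<equiv> conjugate g x"

lemma subgroup_K: "subgroup K G"
  by (rule normal_imp_subgroup[OF normal_square])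

lemma subgroup_x: "subgroup \<langle>x\<rangle> G"
  by (rule cyclic_subgroup[OF x])

lemma subgroup_N: "subgroup N G"
  by (rule subgroup_normalizer[OF subgroup_x])

lemma y: "y \<in> carrier G"
  using x g by simp

lemma K_carrier: "k \<in> K \<Longrightarrow> k \<in> carrier G"
  by (rule subgroup.mem_carrier[OF subgroup_K])

lemma K_subset: "K \<subseteq> \<langle>x\<rangle>"
  using cyclic_subset_iff[OF subgroup_x] subgroup.m_closed[OF subgroup_x cyclic_self cyclic_self] by blast

lemma normal_N: "N \<lhd> G"
  by (rule normal_of_index_2[OF subgroup_N index_2])

lemma conjugate_notin_K:
  assumes a: "a \<in> carrier G"
  shows "conjugate a x \<notin> K"
proof
  assume "conjugate a x \<in> K"
  then have "conjugate (inv a) (conjugate a x) \<in> K" by (rule normal_conjugate[OF normal_square inv_closed[OF a]])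
  then have "x \<in> K" using a x by (simp add: conjugate_conjugate)
  then have "card \<langle>x\<rangle> \<le> card K"
    using cyclic_subset_iff[OF subgroup_K] finite_subgroup_carrier[OF subgroup_K fin] by (intro card_mono) auto
  then show False using card_square card_subgroup_pos[OF subgroup_K fin] by simp
qed

lemma r_coset_conjugate_x:
  assumes a: "a \<in> carrier G"
  shows "K #> conjugate a x = (if a \<in> N then K #> x else K #> y)"
proof -
  have in_N: "K #> conjugate n x = K #> x" if n: "n \<in> N" for n
  proof -
    have nc: "n \<in> carrier G" using n normalizer_subset by blast
    have "inv x \<notin> K" using conjugate_notin_K[of \<one>] x subgroup.m_inv_closed[OF subgroup_K, of "inv x"] by auto
    then have "conjugate n x \<otimes> inv x \<in> K"
      using n nc mem_normalizer_cyclic_iff[OF fin x] conjugate_notin_K[OF nc] cyclic_self[of x]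
        subgroup.m_inv_closed[OF subgroup_x] card_subgroup_pos[OF subgroup_K fin]
      by (intro mult_mem_of_relative_index_2[OF subgroup_x subgroup_K K_subset card_square]) auto
    then show ?thesis using r_coset_eq_iff[OF subgroup_K] nc x by simp
  qed
  have "K #> conjugate a x = K #> y" if "a \<notin> N"
  proof -
    have "inv g \<notin> N" using g subgroup.m_inv_closed[OF subgroup_N, of "inv g"] by auto
    then have "inv g \<otimes> a \<in> N" using mult_mem_of_index_2[OF subgroup_N index_2] g a that by simp
    then have "K #> conjugate g (conjugate (inv g \<otimes> a) x) = K #> y"
      using in_N a g x by (intro r_coset_conjugate_cong[OF normal_square]) simp_all
    then show ?thesis using a g x by (simp add: conjugate_conjugate mult_inv_cancel)
  qed
  then show ?thesis using in_N by simp
qed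

lemma r_coset_conjugate_y:
  assumes a: "a \<in> carrier G"
  shows "K #> conjugate a y = (if a \<in> N then K #> y else K #> x)"
proof -
  have "a \<otimes> g \<in> N \<longleftrightarrow> a \<notin> N"
  proof
    assume ag: "a \<otimes> g \<in> N"
    show "a \<notin> N"
    proof
      assume "a \<in> N"
      then have "inv a \<otimes> (a \<otimes> g) \<in> N" using ag subgroup.m_inv_closed subgroup.m_closed subgroup_N by metis
      then show False using a g by (simp add: inv_mult_cancel)
    qed
  qed (use mult_mem_of_index_2[OF subgroup_N index_2 a _ g] in blast)
  then show ?thesis using r_coset_conjugate_x[of "a \<otimes> g"] a g x by (simp add: conjugate_conjugate)
qed

lemma x_mem_N: "x \<in> N"
  using subset_normalizer[OF subgroup_x fin] cyclic_self by blast

lemma r_coset_commute: "K #> (x \<otimes> y) = K #> (y \<otimes> x)"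
proof -
  have "K #> (conjugate x y \<otimes> x) = K #> (y \<otimes> x)"
    using r_coset_conjugate_y[OF x] x_mem_N x y by (intro r_coset_mult_cong[OF normal_square]) simp_all
  moreover have "conjugate x y \<otimes> x = x \<otimes> y" using x y unfolding conjugate_def[of x] by (simp add: m_assoc)
  ultimately show ?thesis by simp
qed

lemma r_coset_conjugate_product:
  assumes a: "a \<in> carrier G"
  shows "K #> conjugate a (x \<otimes> y) = K #> (x \<otimes> y)"
proof (cases "a \<in> N")
  case True
  then have "K #> (conjugate a x \<otimes> conjugate a y) = K #> (x \<otimes> y)"
    using r_coset_conjugate_x[OF a] r_coset_conjugate_y[OF a] a x y
    by (intro r_coset_mult_cong[OF normal_square]) simp_all
  then show ?thesis using a x y by (simp add: conjugate_mult)
next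
  case False
  then have "K #> (conjugate a x \<otimes> conjugate a y) = K #> (y \<otimes> x)"
    using r_coset_conjugate_x[OF a] r_coset_conjugate_y[OF a] a x y
    by (intro r_coset_mult_cong[OF normal_square]) simp_all
  then show ?thesis using r_coset_commute a x y by (simp add: conjugate_mult)
qed

lemma square_y_mem_K: "y \<otimes> y \<in> K"
  using normal_conjugate[OF normal_square g(1) cyclic_self] g x by (simp add: conjugate_mult)

text \<open>\<open>G'\<close> centralises \<open>xy\<close>, and it contains \<open>x\<close>.\<close>

lemma commute:
  assumes xD: "x \<in> derived_subgroup" and order: "ord (x \<otimes> x) = 2 ^ f"
  shows "x \<otimes> y = y \<otimes> x"
proof -
  let ?u = "x \<otimes> y"
  have u: "?u \<in> carrier G" using x y by simp
  have uD: "?u \<in> derived_subgroup"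
    using xD normal_conjugate[OF derived_self_is_normal g(1) xD]
      subgroup.m_closed[OF normal_imp_subgroup[OF derived_self_is_normal]] by blast
  have "conjugate x ?u = ?u"
  proof (rule derived_centralizes_coset[OF fin _ order normal_square u _ _ _ xD])
    show "x \<otimes> x \<in> carrier G" using x by simp
    have "conjugate ?u (x \<otimes> x) = x \<otimes> x"
      using derived_centralizes_normal_cyclic[OF fin _ normal_square uD] x by simp
    then show "?u \<otimes> (x \<otimes> x) = x \<otimes> x \<otimes> ?u" using conjugate_eq_self_iff[OF u] x by simp
    have "K #> (?u \<otimes> ?u) = K #> (?u \<otimes> (y \<otimes> x))"
      by (rule r_coset_mult_cong[OF normal_square u u _ _ refl r_coset_commute]) (use x y in simp_all)
    also have "?u \<otimes> (y \<otimes> x) = conjugate x (y \<otimes> y) \<otimes> (x \<otimes> x)"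
      using x y unfolding conjugate_def[of x] by (simp add: group_word_simps)
    also have "K #> \<dots> = K"
      using normal_conjugate[OF normal_square x square_y_mem_K] cyclic_self[of "x \<otimes> x"]
      by (intro coset_join2 subgroup_K) (auto intro: subgroup.m_closed[OF subgroup_K] K_carrier)
    finally show "?u \<otimes> ?u \<in> K" using coset_join1[OF _ _ subgroup_K] u by blast
    fix a assume a: "a \<in> carrier G"
    then have "conjugate a ?u \<in> ?u <# K"
      using r_coset_conjugate_product[OF a] rcos_self[OF _ subgroup_K, of "conjugate a ?u"] u
        normal.coset_eq[OF normal_square] by auto
    then show "\<exists>k\<in>K. conjugate a ?u = ?u \<otimes> k" by (auto simp: l_coset_def)
  qed
  then have "x \<otimes> ?u = ?u \<otimes> x" using conjugate_eq_self_iff[OF x u] by simp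
  then show ?thesis using x y by (simp add: m_assoc)
qed

lemma y_notin_cyclic: "y \<notin> \<langle>x\<rangle>"
  using g mem_normalizer_cyclic_iff[OF fin x] by blast

lemma normal_pair: "generate G {x, y} \<lhd> G"
proof (rule normal_generate_of_conjugates)
  let ?E = "generate G {x, y}"
  have E: "subgroup ?E G" using x y by (intro generate_is_subgroup) auto
  have mem: "x \<in> ?E" "y \<in> ?E" by (auto intro: generate.incl)
  have "K \<subseteq> ?E" using cyclic_subset_iff[OF E] subgroup.m_closed[OF E mem(1,1)] by blast
  then have coset: "K #> z \<subseteq> ?E" if "z \<in> ?E" for z
    using that subgroup.m_closed[OF E] by (auto simp: r_coset_def)
  fix a s assume a: "a \<in> carrier G" and s: "s \<in> {x, y}"
  then have "K #> conjugate a s = K #> x \<or> K #> conjugate a s = K #> y"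
    using r_coset_conjugate_x[OF a] r_coset_conjugate_y[OF a] by (metis insertE singletonD)
  moreover have "conjugate a s \<in> K #> conjugate a s"
    using a s x y by (intro rcos_self subgroup_K) auto
  ultimately show "conjugate a s \<in> ?E" using coset[OF mem(1)] coset[OF mem(2)] by blast
qed (use x y in auto)

lemma metabelian_of_small_order:
  assumes comm: "x \<otimes> y = y \<otimes> x" and small: "order G < 10 * card \<langle>x\<rangle>"
  shows "metabelian G"
proof -
  let ?E = "generate G {x, y}"
  have E: "subgroup ?E G" by (rule normal_imp_subgroup[OF normal_pair])
  have sub: "\<langle>x\<rangle> \<subseteq> ?E" by (rule mono_generate) simp
  then obtain q where q: "card ?E = card \<langle>x\<rangle> * q" using card_subgroup_dvd[OF subgroup_x E] by blast
  have "\<langle>x\<rangle> \<subset> ?E" using sub y_notin_cyclic generate.incl[of y "{x, y}" G] by blast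
  then have "card \<langle>x\<rangle> < card ?E" by (rule psubset_card_mono[OF finite_subgroup_carrier[OF E fin]])
  then have "q \<ge> 2" using q by (cases q; cases "q - 1") auto
  then have "2 * card \<langle>x\<rangle> \<le> card ?E" using q by simp
  then have "index ?E * card ?E < 5 * card ?E" using small lagrange[OF E] by simp
  then have "derived_subgroup \<subseteq> ?E" by (intro derived_subset_of_index_less_5 fin normal_pair) simp
  moreover have "c \<otimes> d = d \<otimes> c" if "c \<in> ?E" "d \<in> ?E" for c d
    by (rule generate_commute[OF _ _ that]) (use x y comm in auto)
  ultimately show ?thesis by (auto simp: metabelian_iff)
qed

lemma exists_involution_factor:
  assumes comm: "x \<otimes> y = y \<otimes> x"
  obtains v t where "v \<in> \<langle>x\<rangle>" "t \<in> carrier G" "t \<notin> \<langle>x\<rangle>" "t \<otimes> t = \<one>" "y = v \<otimes> t"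
proof -
  obtain j :: nat where j: "y \<otimes> y = (x \<otimes> x) [^] j"
    using square_y_mem_K mem_cyclic_iff_nat_pow[OF fin, of "x \<otimes> x"] x by auto
  define v where "v = x [^] j"
  define t where "t = inv v \<otimes> y"
  have v: "v \<in> carrier G" "v \<in> \<langle>x\<rangle>" using x mem_cyclic_iff_nat_pow[OF fin x] by (auto simp: v_def)
  have t: "t \<in> carrier G" using v y by (simp add: t_def)
  have y_eq: "y = v \<otimes> t" using v y unfolding t_def by (simp only: mult_inv_cancel)
  have t_notin: "t \<notin> \<langle>x\<rangle>" using y_eq y_notin_cyclic subgroup.m_closed[OF subgroup_x v(2), of t] by auto
  have "t \<otimes> t = inv v \<otimes> (y \<otimes> inv v) \<otimes> y" using v y by (simp add: t_def m_assoc)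
  also have "y \<otimes> inv v = inv v \<otimes> y"
    using generate_centralizes[of "{x}" y "inv v"] subgroup.m_inv_closed[OF subgroup_x v(2)] x y comm by simp
  also have "inv v \<otimes> (inv v \<otimes> y) \<otimes> y = inv v \<otimes> inv v \<otimes> (y \<otimes> y)" using v y by (simp add: m_assoc)
  also have "y \<otimes> y = v \<otimes> v" unfolding j v_def using x by (simp add: pow_mult_distrib)
  finally have "t \<otimes> t = \<one>" using v by (simp add: group_word_simps)
  then show ?thesis using that[OF v(2) t t_notin _ y_eq] by blast
qed

text \<open>Modulo the central involution \<open>t\<close> all conjugates of \<open>x\<close> lie in \<open>\<langle>x\<rangle>\<close>.\<close>

lemma derived_centralizes_of_central_involution:
  assumes v: "v \<in> \<langle>x\<rangle>" and t: "t \<in> carrier G" "t \<notin> \<langle>x\<rangle>" "t \<otimes> t = \<one>" and y_eq: "y = v \<otimes> t"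
    and central: "\<And>a. a \<in> carrier G \<Longrightarrow> conjugate a t = t" and c: "c \<in> derived_subgroup"
  shows "conjugate c x = x"
proof -
  have T: "\<langle>t\<rangle> \<lhd> G" using normal_cyclic_iff[OF t(1)] central cyclic_self by simp
  have vc: "v \<in> carrier G" by (rule subgroup.mem_carrier[OF subgroup_x v])
  have v_t: "v \<otimes> t = t \<otimes> v" using central[OF vc] vc t by (simp add: conjugate_eq_self_iff)
  have T_y: "\<langle>t\<rangle> #> y = \<langle>t\<rangle> #> v"
    using vc t by (subst r_coset_eq_iff[OF normal_imp_subgroup[OF T]]) (simp_all add: y_eq v_t m_assoc cyclic_self)
  have "\<langle>t\<rangle> #> conjugate c x = \<langle>t\<rangle> #> x"
  proof (rule derived_centralizes_normal_cyclic_mod[OF fin T x _ c])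
    fix a assume a: "a \<in> carrier G"
    have "conjugate a x \<in> K #> (if a \<in> N then x else y)"
      using rcos_self[OF _ subgroup_K, of "conjugate a x"] a x r_coset_conjugate_x[OF a] by (auto split: if_splits)
    then obtain k where k: "k \<in> K" "conjugate a x = k \<otimes> (if a \<in> N then x else y)" by (auto simp: r_coset_def)
    let ?z = "k \<otimes> (if a \<in> N then x else v)"
    have "?z \<in> \<langle>x\<rangle>" using k K_subset cyclic_self[of x] v subgroup.m_closed[OF subgroup_x] by auto
    moreover have "\<langle>t\<rangle> #> conjugate a x = \<langle>t\<rangle> #> ?z"
      unfolding k(2) using T_y K_carrier[OF k(1)] x y vc by (intro r_coset_mult_cong[OF T]) auto
    ultimately show "\<exists>z\<in>\<langle>x\<rangle>. \<langle>t\<rangle> #> conjugate a x = \<langle>t\<rangle> #> z" by blast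
  qed
  then have "conjugate c x \<otimes> inv x \<in> \<langle>t\<rangle>"
    using r_coset_eq_iff[OF normal_imp_subgroup[OF T]] derived_subgroup_carrier[OF c] x by simp
  then obtain n :: nat where n: "conjugate c x \<otimes> inv x = t [^] n"
    using mem_cyclic_iff_nat_pow[OF fin t(1)] by blast
  have "derived_subgroup \<subseteq> N" by (rule derived_subset_of_index_less_5[OF fin normal_N]) (simp add: index_2)
  then have "conjugate c x \<in> \<langle>x\<rangle>" using c mem_normalizer_cyclic_iff[OF fin x] by blast
  then have "t [^] n \<in> \<langle>x\<rangle>"
    using n subgroup.m_closed[OF subgroup_x _ subgroup.m_inv_closed[OF subgroup_x cyclic_self]] by metis
  moreover have "t [^] n = \<one> \<or> t [^] n = t" using t by (induction n) auto
  ultimately have "conjugate c x \<otimes> inv x = \<one>" using n t(2) by auto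
  then show ?thesis using derived_subgroup_carrier[OF c] x by (metis conjugate_closed inv_equality inv_inv inv_closed)
qed

end

section \<open>Groups with tp(G) > 4/81\<close>

lemma index_multiplicity_cases:
  fixes r m a :: nat
  assumes r: "r \<ge> 2" and only_2: "\<And>q. prime q \<Longrightarrow> q dvd r \<Longrightarrow> q = 2"
    and a: "a \<in> {1..4}" "(r - 1) * m = 2 * a"
  shows "r = 2 \<or> r = 4 \<and> m = 2"
proof -
  have not_dvd: "\<not> 3 dvd r" "\<not> 5 dvd r" "\<not> 7 dvd r"
    using only_2[of 3] only_2[of 5] only_2[of 7] by fastforce+
  have "r - 1 dvd 2 * a" using a(2) by (metis dvd_triv_left)
  then have "r - 1 \<le> 2 * a" using a(1) by (intro dvd_imp_le) auto
  then have "r \<in> {2, 3, 4, 5, 6, 7, 8, 9}" using r a(1) by auto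
  then consider "r = 2" | "r = 4" | "r = 8" using not_dvd by auto
  then show ?thesis
  proof cases
    case 2
    then have "3 * m = 2 * a" using a(2) by simp
    then show ?thesis using 2 a(1) by simp presburger
  next
    case 3
    then have "7 * m = 2 * a" using a(2) by simp
    then show ?thesis using a(1) by simp presburger
  qed simp
qed

locale high_tp_group = group +
  assumes fin: "finite (carrier G)" and high_tp: "tp G > 4 / 81"
begin

lemma transversal_prob_gt:
  assumes "subgroup H G"
  shows "transversal_prob G H > 4 / 81"
proof -
  have "tp G \<le> transversal_prob G H"
    unfolding tp_def using assms finite_subgroups[OF fin] by (intro Min_le) auto
  then show ?thesis using high_tp by simp
qed

lemma index_normalizer_cases_prime_power:
  assumes H: "subgroup H G" and p: "prime p" "card H = p ^ e" and nonnormal: "\<not> H \<lhd> G"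
  obtains
    (single) g k m where "g \<in> carrier G" "carrier G - normalizer G H = double_coset H g"
      "card (normalizer G H) = m * card H" "(index (normalizer G H) - 1) * m = k"
      "p = 3 \<and> k = 3 \<or> p = 2 \<and> k = 4"
  | (pairs) a m where "p = 2" "a \<in> {1..4}"
      "card (normalizer G H) = m * card H" "(index (normalizer G H) - 1) * m = 2 * a"
      "\<And>g. g \<in> carrier G - normalizer G H \<Longrightarrow> 2 * card (H \<inter> conjugate g ` H) = card H"
proof -
  obtain m where m: "card (normalizer G H) = m * card H"
      "card (carrier G - normalizer G H) = (index (normalizer G H) - 1) * m * card H"
    by (rule index_normalizer_cases[OF fin H])
  have cancel: "(index (normalizer G H) - 1) * m = k" if "card (carrier G - normalizer G H) = k * card H" for k
    using that m(2) card_subgroup_pos[OF H fin] by (metis mult_right_cancel less_not_refl)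
  show ?thesis
  proof (cases rule: nontrivial_double_cosets_cases[OF H fin transversal_prob_gt[OF H] p nonnormal])
    case (1 g k)
    then show ?thesis using that(1) m(1) cancel by blast
  next
    case (2 a)
    then show ?thesis using that(2) m(1) cancel by blast
  qed
qed

lemma two_subgroup_normal_if_large:
  assumes H: "subgroup H G" "card H = 2 ^ e" and large: "order G > 16 * card H"
  shows "H \<lhd> G"
proof (rule ccontr)
  assume nonnormal: "\<not> H \<lhd> G"
  let ?r = "index (normalizer G H)"
  obtain m where m: "card (normalizer G H) = m * card H"
      "card (carrier G - normalizer G H) = (?r - 1) * m * card H"
    by (rule index_normalizer_cases[OF fin H(1)])
  have "(?r - 1) * m * card H \<le> 8 * card H"
    using card_Diff_normalizer_le_2_group[OF H(1) fin transversal_prob_gt[OF H(1)] H(2)] m(2) by simp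
  then have small: "(?r - 1) * m \<le> 8" using card_subgroup_pos[OF H(1) fin] by simp
  have "?r \<le> 2 * (?r - 1)" using index_normalizer_ge_2[OF fin H(1) nonnormal] by simp
  then have "?r * m \<le> 2 * (?r - 1) * m" by (rule mult_le_mono1)
  also have "\<dots> \<le> 2 * 8" using mult_le_mono2[OF small, of 2] by (simp only: mult.assoc)
  finally have "?r * m * card H \<le> 2 * 8 * card H" by (rule mult_le_mono1)
  moreover have "order G = ?r * m * card H"
    using lagrange[OF subgroup_normalizer[OF H(1)]] m(1) by (simp add: mult.assoc)
  ultimately show False using large by linarith
qed

lemma involution_central_if_large:
  assumes t: "t \<in> carrier G" "t \<noteq> \<one>" "t \<otimes> t = \<one>" and large: "order G > 32" and a: "a \<in> carrier G"
  shows "conjugate a t = t"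
proof (rule conjugate_involution_in_normal_cyclic[OF fin t(1) _ cyclic_self t(3) a])
  have "t [^] (2::nat) = \<one>" using t by (simp add: numeral_2_eq_2)
  then have "ord t dvd 2" using pow_eq_id[OF t(1), of 2] by simp
  moreover have "ord t \<noteq> 1" using t ord_eq_1 by blast
  ultimately have "card \<langle>t\<rangle> = 2 ^ 1"
    using generate_pow_card[OF t(1)] by (metis prime_nat_iff power_one_right two_is_prime_nat)
  then show "\<langle>t\<rangle> \<lhd> G" using two_subgroup_normal_if_large[OF cyclic_subgroup[OF t(1)], of 1] large by simp
qed

text \<open>If the order were larger, an involution would be central and hence normalise \<open>\<langle>y\<rangle>\<close>.\<close>

lemma order_le_32_of_self_normalizing:
  assumes y: "y \<in> carrier G" "ord y = 3 ^ e" and self: "normalizer G \<langle>y\<rangle> = \<langle>y\<rangle>"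
    and order: "order G = 4 * 3 ^ e"
  shows "order G \<le> 32"
proof (rule ccontr)
  assume large: "\<not> order G \<le> 32"
  have H: "subgroup \<langle>y\<rangle> G" by (rule cyclic_subgroup[OF y(1)])
  obtain I where I: "subgroup I G" "card I = 2"
    using sylow_thm[of 2 G 1 "2 * 3 ^ e"] order fin is_group by auto
  have "I \<noteq> {\<one>}" using I by auto
  then obtain t where t: "t \<in> I" "t \<noteq> \<one>" using subgroup.one_closed[OF I(1)] by blast
  have tc: "t \<in> carrier G" by (rule subgroup.mem_carrier[OF I(1) t(1)])
  have ord_t: "ord t dvd 2" using ord_dvd_card_subgroup[OF I(1) t(1)] I by simp
  then have "t \<otimes> t = \<one>" using pow_eq_id[OF tc, of 2] tc by (simp add: numeral_2_eq_2)
  then have "conjugate y t = t" using involution_central_if_large[OF tc t(2) _ _ y(1)] large by simp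
  then have "conjugate t y = y" using tc y by (simp add: conjugate_eq_self_iff)
  then have "t \<in> \<langle>y\<rangle>" using self mem_normalizer_cyclic_iff[OF fin y(1)] cyclic_self tc by simp
  then have "ord t dvd card \<langle>y\<rangle>" by (rule ord_dvd_card_subgroup[OF H])
  then have "ord t dvd 3 ^ e" using generate_pow_card[OF y(1)] y(2) by simp
  moreover have "coprime 2 (3 ^ e :: nat)" by simp
  ultimately have "ord t dvd 1" using ord_t coprime_common_divisor by blast
  then show False using ord_eq_1[OF tc] t(2) by simp
qed

lemma metabelian_of_nonnormal_3_element:
  assumes y: "y \<in> carrier G" "ord y = 3 ^ e" and nonnormal: "\<not> \<langle>y\<rangle> \<lhd> G"
  shows "metabelian G"
proof -
  let ?N = "normalizer G \<langle>y\<rangle>"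
  have H: "subgroup \<langle>y\<rangle> G" and cardH: "card \<langle>y\<rangle> = 3 ^ e"
    using cyclic_subgroup generate_pow_card y by simp_all
  have three: "prime (3::nat)" by simp
  obtain g m where g: "g \<in> carrier G" "carrier G - ?N = double_coset \<langle>y\<rangle> g"
    and m: "card ?N = m * card \<langle>y\<rangle>" "(index ?N - 1) * m = 3"
    by (rule index_normalizer_cases_prime_power[OF H three cardH nonnormal]) auto
  have "index ?N - 1 dvd 3" using m(2) by (metis dvd_triv_left)
  then have "index ?N - 1 = 1 \<or> index ?N - 1 = 3" using three by (auto simp: prime_nat_iff)
  then consider "index ?N = 2" | "index ?N = 4" "m = 1" using m(2) by fastforce
  then show ?thesis
  proof cases
    case 1
    then show ?thesis by (intro metabelian_of_index_2_double_coset[OF fin y(1) g(1) _ g(2)])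
  next
    case 2
    have self: "?N = \<langle>y\<rangle>"
      using card_subset_eq[OF finite_subgroup_carrier[OF subgroup_normalizer[OF H] fin] subset_normalizer[OF H fin]]
        m(1) 2 by simp
    have order: "order G = 4 * 3 ^ e" using lagrange[OF H] 2 self cardH by simp
    have "(3::nat) ^ e < 3 ^ 2" using order_le_32_of_self_normalizing[OF y self order] order by simp
    then have "e < 2" using power_less_imp_less_exp[of 3 e 2] by simp
    moreover have "e \<noteq> 0"
    proof
      assume "e = 0"
      then have "y = \<one>" using y ord_eq_1[OF y(1)] by simp
      then show False using nonnormal one_is_normal by (simp add: generate_one)
    qed
    ultimately have "e = 1" by simp
    then show ?thesis using metabelian_of_order_12[OF _ H _ self] order cardH by simp
  qed
qed

lemma odd_prime_power_normal:
  assumes not_metabelian: "\<not> metabelian G" and y: "y \<in> carrier G" "ord y = q ^ e" and q: "prime q" "q \<noteq> 2"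
  shows "\<langle>y\<rangle> \<lhd> G"
proof (rule ccontr)
  assume nonnormal: "\<not> \<langle>y\<rangle> \<lhd> G"
  have H: "subgroup \<langle>y\<rangle> G" and cardH: "card \<langle>y\<rangle> = q ^ e"
    using cyclic_subgroup generate_pow_card y by simp_all
  have "q = 3" by (rule index_normalizer_cases_prime_power[OF H q(1) cardH nonnormal]) (use q in auto)
  then show False using metabelian_of_nonnormal_3_element[OF y(1) _ nonnormal] y(2) not_metabelian by simp
qed

lemma prime_divisor_index_normalizer:
  assumes not_metabelian: "\<not> metabelian G" and x: "x \<in> derived_subgroup" and q: "prime q" "q dvd index (normalizer G \<langle>x\<rangle>)"
  shows "q = 2"
proof (rule ccontr)
  assume q2: "q \<noteq> 2"
  have xc: "x \<in> carrier G" by (rule derived_subgroup_carrier[OF x])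
  have N: "subgroup (normalizer G \<langle>x\<rangle>) G" by (rule subgroup_normalizer[OF cyclic_subgroup[OF xc]])
  have "\<not> q dvd index (normalizer G \<langle>x\<rangle>)"
  proof (rule prime_not_dvd_relative_index[OF fin subgroup_self N normalizer_subset q(1)])
    fix y e assume y: "y \<in> carrier G" "ord y = q ^ e"
    have "conjugate x y = y"
      by (rule derived_centralizes_normal_cyclic[OF fin y(1) odd_prime_power_normal[OF not_metabelian y q(1) q2] x])
    then have "conjugate y x = x" using xc y(1) by (simp add: conjugate_eq_self_iff)
    then show "y \<in> normalizer G \<langle>x\<rangle>" using mem_normalizer_cyclic_iff[OF fin xc] y(1) cyclic_self by simp
  qed (use lagrange[OF N] in \<open>simp add: order_def\<close>)
  then show False using q(2) by blast
qed

lemma metabelian_or_derived_centralizes_index_2: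
  assumes x: "x \<in> derived_subgroup" "ord (x \<otimes> x) = 2 ^ f"
    and K: "card \<langle>x\<rangle> = 2 * card \<langle>x \<otimes> x\<rangle>" "\<langle>x \<otimes> x\<rangle> \<lhd> G"
    and index_2: "index (normalizer G \<langle>x\<rangle>) = 2" and c: "c \<in> derived_subgroup"
  shows "metabelian G \<or> conjugate c x = x"
proof -
  have xc: "x \<in> carrier G" by (rule derived_subgroup_carrier[OF x(1)])
  have "normalizer G \<langle>x\<rangle> \<noteq> carrier G"
    using lagrange[OF subgroup_self] lagrange[OF subgroup_normalizer[OF cyclic_subgroup[OF xc]]] index_2 fin
    by (auto simp: order_def)
  then obtain g where g: "g \<in> carrier G" "g \<notin> normalizer G \<langle>x\<rangle>" using normalizer_subset by blast
  interpret pair: conjugate_pair G x g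
    by (intro conjugate_pair.intro conjugate_pair_axioms.intro is_group fin xc K index_2 g)
  have comm: "x \<otimes> pair.y = pair.y \<otimes> x" by (rule pair.commute[OF x])
  obtain v t where t: "v \<in> \<langle>x\<rangle>" "t \<in> carrier G" "t \<notin> \<langle>x\<rangle>" "t \<otimes> t = \<one>" "pair.y = v \<otimes> t"
    by (rule pair.exists_involution_factor[OF comm])
  consider "order G < 10 * card \<langle>x\<rangle>" | "order G > 32" | "10 * card \<langle>x\<rangle> \<le> 32"
    by linarith
  then show ?thesis
  proof cases
    case 1
    then show ?thesis using pair.metabelian_of_small_order[OF comm] by simp
  next
    case 2
    have "t \<noteq> \<one>" using t(3) subgroup.one_closed[OF pair.subgroup_x] by blast
    then have "conjugate a t = t" if "a \<in> carrier G" for a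
      using involution_central_if_large[OF t(2) _ t(4) 2 that] by blast
    then show ?thesis using pair.derived_centralizes_of_central_involution[OF t _ c] by blast
  next
    case 3
    then have "card pair.K = 1" using K(1) card_subgroup_pos[OF pair.subgroup_K fin] by linarith
    then have "pair.K = {\<one>}" using subgroup.one_closed[OF pair.subgroup_K] by (auto simp: card_1_singleton_iff)
    moreover have "c \<in> pair.N"
      using derived_subset_of_index_less_5[OF fin pair.normal_N] index_2 c by auto
    ultimately have "{\<one>} #> conjugate c x = {\<one>} #> x"
      using pair.r_coset_conjugate_x[OF derived_subgroup_carrier[OF c]] by simp
    then show ?thesis using derived_subgroup_carrier[OF c] xc by (simp add: r_coset_def)
  qed
qed

lemma derived_centralizes_2_element:
  assumes not_metabelian: "\<not> metabelian G" and x: "x \<in> derived_subgroup" "ord x = 2 ^ e" and c: "c \<in> derived_subgroup"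
  shows "conjugate c x = x"
proof (rule ccontr)
  assume moved: "conjugate c x \<noteq> x"
  let ?N = "normalizer G \<langle>x\<rangle>"
  have xc: "x \<in> carrier G" by (rule derived_subgroup_carrier[OF x(1)])
  have H: "subgroup \<langle>x\<rangle> G" and cardH: "card \<langle>x\<rangle> = 2 ^ e"
    using cyclic_subgroup generate_pow_card xc x(2) by simp_all
  have nonnormal: "\<not> \<langle>x\<rangle> \<lhd> G" using derived_centralizes_normal_cyclic[OF fin xc _ c] moved by blast
  have r2: "index ?N \<ge> 2" by (rule index_normalizer_ge_2[OF fin H nonnormal])
  have only_2: "q = 2" if "prime q" "q dvd index ?N" for q
    by (rule prime_divisor_index_normalizer[OF not_metabelian x(1) that])
  show False
  proof (rule index_normalizer_cases_prime_power[OF H two_is_prime_nat cardH nonnormal])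
    fix g k m assume g: "g \<in> carrier G" "carrier G - ?N = double_coset \<langle>x\<rangle> g"
      and k: "(index ?N - 1) * m = k" "(2::nat) = 3 \<and> k = 3 \<or> (2::nat) = 2 \<and> k = 4"
    have "(index ?N - 1) * m = 2 * 2" using k by simp
    then have "index ?N = 2" using index_multiplicity_cases[OF r2 only_2, of 2 m] by auto
    then show False
      using metabelian_of_index_2_double_coset[OF fin xc g(1) _ g(2)] not_metabelian by blast
  next
    fix a m assume a: "a \<in> {1..4}" "(index ?N - 1) * m = 2 * a" and N: "card ?N = m * card \<langle>x\<rangle>"
      and meet: "\<And>g. g \<in> carrier G - ?N \<Longrightarrow> 2 * card (\<langle>x\<rangle> \<inter> conjugate g ` \<langle>x\<rangle>) = card \<langle>x\<rangle>"
    obtain g where "g \<in> carrier G - ?N" using nonnormal normal_iff_normalizer[OF H fin] normalizer_subset by blast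
    then have even: "even (ord x)" using meet generate_pow_card[OF xc] by (metis dvd_triv_left)
    note K = normal_square_cyclic[OF fin xc even meet]
    have "index ?N = 2 \<or> index ?N = 4 \<and> m = 2"
      by (rule index_multiplicity_cases[OF r2 only_2 a])
    then show False
    proof
      assume "index ?N = 2"
      moreover have "e \<noteq> 0" using even x(2) by (intro notI) simp
      then have "ord (x \<otimes> x) = 2 ^ (e - 1)"
        using K(1) cardH generate_pow_card[of "x \<otimes> x"] xc by (cases e) auto
      ultimately show False
        using metabelian_or_derived_centralizes_index_2[OF x(1) _ K _ c] not_metabelian moved by blast
    next
      assume "index ?N = 4 \<and> m = 2"
      then show False using index_normalizer_ne_4[OF fin x K(2,1)] N by simp
    qed
  qed
qed

theorem metabelian_of_high_tp: "metabelian G"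
proof (rule ccontr)
  assume not_metabelian: "\<not> metabelian G"
  have "metabelian G"
  proof (rule metabelianI_prime_power[OF fin])
    fix x q e c assume x: "x \<in> derived_subgroup" "prime (q::nat)" "ord x = q ^ e" and c: "c \<in> derived_subgroup"
    have xc: "x \<in> carrier G" by (rule derived_subgroup_carrier[OF x(1)])
    show "conjugate c x = x"
    proof (cases "q = 2")
      case True
      then show ?thesis using derived_centralizes_2_element[OF not_metabelian x(1) _ c] x(3) by blast
    next
      case False
      then show ?thesis
        using derived_centralizes_normal_cyclic[OF fin xc odd_prime_power_normal[OF not_metabelian xc x(3,2)] c] by blast
    qed
  qed
  then show False using not_metabelian by blast
qed

end

section \<open>Sharpness\<close>

context group
begin

lemma sum_nontrivial_coset_count_less:
  assumes H: "subgroup H G" and fin: "finite (carrier G)"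
  shows "(\<Sum>D\<in>nontrivial_double_cosets H. coset_count H D) < index H"
proof -
  let ?D = "double_coset H \<one>"
  have finite: "finite (double_cosets H)" by (rule finite_double_cosets[OF H fin])
  have one: "coset_count H ?D = 1"
    using coset_count_eq_1_iff[OF H fin one_closed] subgroup.one_closed[OF subgroup_normalizer[OF H]] by blast
  have mem: "?D \<in> double_cosets H" by (simp add: double_cosets_def)
  have "(\<Sum>D\<in>nontrivial_double_cosets H. coset_count H D) < (\<Sum>D\<in>double_cosets H. coset_count H D)"
    by (rule sum_strict_mono2[OF finite _ _ _]) (use one mem in \<open>auto simp: nontrivial_double_cosets_def\<close>)
  then show ?thesis by (simp add: sum_coset_count[OF H fin])
qed

lemma transversal_prob_ge_card_3:
  assumes H: "subgroup H G" and fin: "finite (carrier G)" and card: "card H = 3" "index H \<le> 9"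
  shows "transversal_prob G H \<ge> 4 / 81"
proof -
  let ?S = "nontrivial_double_cosets H"
  have count: "coset_count H D = 3" if D: "D \<in> ?S" for D
  proof -
    have "coset_count H D dvd 3"
      using D coset_count_dvd[OF H fin, of D] card by (simp add: nontrivial_double_cosets_def)
    then show ?thesis using coset_count_ge_2[OF H fin D] prime_nat_iff[of 3] by auto
  qed
  have "3 * card ?S < 9" using sum_nontrivial_coset_count_less[OF H fin] card(2) by (simp add: count)
  then have "4 / 81 \<le> (2 / 9 :: real) ^ card ?S"
    using power_decreasing[of "card ?S" 2 "2 / 9 :: real"] by (simp add: power_divide)
  then show ?thesis
    by (simp add: transversal_prob_eq_prod_nontrivial[OF H fin] count fact_ratio_small)
qed

lemma transversal_prob_ge_index_le_6:
  assumes H: "subgroup H G" and fin: "finite (carrier G)" and index: "index H \<le> 6" and dvd: "\<not> 5 dvd card H"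
  shows "transversal_prob G H \<ge> 4 / 81"
proof -
  let ?S = "nontrivial_double_cosets H"
  have finite: "finite ?S" by (rule finite_nontrivial_double_cosets[OF H fin])
  have sum: "(\<Sum>D\<in>?S. coset_count H D) \<le> 5" using sum_nontrivial_coset_count_less[OF H fin] index by simp
  \<comment> \<open>\<open>11/20\<close> satisfies \<open>(11/20)\<^sup>k \<le> k!/k\<^sup>k\<close> for \<open>k \<le> 4\<close> and still \<open>(11/20)\<^sup>5 \<ge> 4/81\<close>.\<close>
  have ratio: "(11/20) ^ coset_count H D \<le> fact_ratio (coset_count H D)" if D: "D \<in> ?S" for D
  proof -
    have "coset_count H D dvd card H"
      using D coset_count_dvd[OF H fin] by (simp add: nontrivial_double_cosets_def)
    then have "coset_count H D \<noteq> 5" using dvd by auto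
    moreover have "coset_count H D \<le> 5"
      using member_le_sum[OF D _ finite, of "coset_count H"] sum by simp
    ultimately have "coset_count H D \<in> {2, 3, 4}" using coset_count_ge_2[OF H fin D] by auto
    then show ?thesis using fact_ratio_small by (auto simp: power_divide)
  qed
  have "4/81 \<le> (11/20 :: real) ^ 5" by (simp add: power_divide)
  also have "\<dots> \<le> (11/20) ^ (\<Sum>D\<in>?S. coset_count H D)" using sum by (intro power_decreasing) auto
  also have "\<dots> = (\<Prod>D\<in>?S. (11/20) ^ coset_count H D)" by (simp only: power_sum)
  also have "\<dots> \<le> transversal_prob G H"
    unfolding transversal_prob_eq_prod_nontrivial[OF H fin] by (intro prod_mono) (use ratio in auto)
  finally show ?thesis .
qed

lemma normal_of_card_le_2:
  assumes H: "subgroup H G" "finite H" "card H \<le> 2"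
    and central: "\<And>t a. t \<in> carrier G \<Longrightarrow> t \<otimes> t = \<one> \<Longrightarrow> a \<in> carrier G \<Longrightarrow> t \<otimes> a = a \<otimes> t"
  shows "H \<lhd> G"
proof (rule normal_invI[OF H(1)])
  fix a t assume a: "a \<in> carrier G" and t: "t \<in> H"
  have tc: "t \<in> carrier G" by (rule subgroup.mem_carrier[OF H(1) t])
  have "card H \<noteq> 0" using H(2) t by auto
  then have "card H dvd 2" using H(3) by (auto simp: le_Suc_eq numeral_2_eq_2)
  then have "ord t dvd 2" using ord_dvd_card_subgroup[OF H(1) t] dvd_trans by blast
  then have "t \<otimes> t = \<one>" using pow_eq_id[OF tc, of 2] tc by (simp add: numeral_2_eq_2)
  then have "conjugate a t = t" using central[OF tc _ a] a tc by (simp add: conjugate_eq_self_iff)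
  then show "a \<otimes> t \<otimes> inv a \<in> H" using t by (simp add: conjugate_def)
qed

lemma tp_ge_of_order_24:
  assumes order: "order G = 24"
    and central: "\<And>t a. t \<in> carrier G \<Longrightarrow> t \<otimes> t = \<one> \<Longrightarrow> a \<in> carrier G \<Longrightarrow> t \<otimes> a = a \<otimes> t"
  shows "tp G \<ge> 4 / 81"
proof -
  have fin: "finite (carrier G)" using order by (metis card.infinite order_def zero_neq_numeral)
  have "transversal_prob G H \<ge> 4 / 81" if H: "subgroup H G" for H
  proof -
    have index: "index H * card H = 24" using lagrange[OF H] order by simp
    consider "card H \<le> 2" | "card H = 3" | "card H \<ge> 4" by linarith
    then show ?thesis
    proof cases
      case 1
      then have "H \<lhd> G"
        by (rule normal_of_card_le_2[OF H finite_subgroup_carrier[OF H fin] _ central])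
      then show ?thesis using transversal_prob_normal[OF H fin] by simp
    next
      case 2
      then show ?thesis using index by (intro transversal_prob_ge_card_3[OF H fin]) auto
    next
      case 3
      then have "index H * 4 \<le> 24" using index mult_le_mono2[of 4 "card H" "index H"] by simp
      moreover have "\<not> 5 dvd card H" using dvd_mult[of 5 "card H" "index H"] index by auto
      ultimately show ?thesis by (intro transversal_prob_ge_index_le_6[OF H fin]) auto
    qed
  qed
  moreover have "finite {H. subgroup H G}" by (rule finite_subgroups[OF fin])
  ultimately show ?thesis unfolding tp_def using subgroup_self by (subst Min_ge_iff) auto
qed

end

lemma (in group_hom) metabelian_of_inj:
  assumes inj: "inj_on h (carrier G)" and metabelian: "metabelian H"
  shows "metabelian G"
proof -
  have image: "h ` derived G (carrier G) \<subseteq> derived H (carrier H)"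
    using H.mono_derived[of "h ` carrier G" "carrier H"] derived_img[of "carrier G"] hom_closed
    by (metis image_subsetI order_refl)
  have "c \<otimes> d = d \<otimes> c" if cd: "c \<in> derived G (carrier G)" "d \<in> derived G (carrier G)" for c d
  proof -
    have carrier: "c \<in> carrier G" "d \<in> carrier G" using cd by (simp_all add: G.derived_subgroup_carrier)
    have "h c \<otimes>\<^bsub>H\<^esub> h d = h d \<otimes>\<^bsub>H\<^esub> h c" using image cd metabelian by (simp add: H.metabelian_iff image_subset_iff)
    then show ?thesis using carrier by (intro inj_onD[OF inj]) simp_all
  qed
  then show ?thesis by (simp add: G.metabelian_iff)
qed

text \<open>The tuple \<open>(a, b, c, d)\<close> stands for the matrix \<open>[[a, b], [c, d]]\<close>.\<close>

type_synonym 'r mat2 = "'r \<times> 'r \<times> 'r \<times> 'r"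

definition mat2_mult :: "'r::comm_ring_1 mat2 \<Rightarrow> 'r mat2 \<Rightarrow> 'r mat2" where
  "mat2_mult = (\<lambda>(a, b, c, d) (e, f, g, h). (a * e + b * g, a * f + b * h, c * e + d * g, c * f + d * h))"

definition SL2 :: "'r::comm_ring_1 mat2 monoid" where
  "SL2 = \<lparr>carrier = {(a, b, c, d). a * d - b * c = 1}, monoid.mult = mat2_mult, one = (1, 0, 0, 1)\<rparr>"

lemma group_SL2: "group SL2"
proof (rule groupI)
  fix x :: "'r::comm_ring_1 mat2"
  assume x: "x \<in> carrier SL2"
  obtain a b c d where abcd: "x = (a, b, c, d)" by (cases x)
  show "\<exists>y\<in>carrier SL2. y \<otimes>\<^bsub>SL2\<^esub> x = \<one>\<^bsub>SL2\<^esub>"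
    using x by (intro bexI[of _ "(d, - b, - c, a)"]) (auto simp: abcd SL2_def mat2_mult_def algebra_simps)
next
  fix x y :: "'r::comm_ring_1 mat2"
  assume "x \<in> carrier SL2" "y \<in> carrier SL2"
  moreover have "(a * e + b * g) * (c * f + d * h) - (a * f + b * h) * (c * e + d * g) =
      (a * d - b * c) * (e * h - f * g)" for a b c d e f g h :: 'r
    by (simp add: algebra_simps)
  ultimately show "x \<otimes>\<^bsub>SL2\<^esub> y \<in> carrier SL2"
    by (auto simp: SL2_def mat2_mult_def)
qed (auto simp: SL2_def mat2_mult_def algebra_simps)

lemma UNIV_3: "(UNIV :: 3 set) = {0, 1, 2}"
proof -
  have "x \<in> {0, 1, 2}" for x :: 3
  proof (cases x)
    case (of_int z)
    then have "z \<in> {0, 1, 2}" by auto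
    then show ?thesis using of_int by auto
  qed
  then show ?thesis by blast
qed

lemma order_SL2_3: "order (SL2 :: 3 mat2 monoid) = 24"
proof -
  have "order (SL2 :: 3 mat2 monoid) = card {(a, b, c, d). a * d - b * c = (1 :: 3)}"
    by (simp add: order_def SL2_def)
  also have "\<dots> = (\<Sum>p\<in>UNIV. of_bool ((\<lambda>(a, b, c, d). a * d - b * c = (1 :: 3)) p))"
    by simp
  also have "\<dots> = (\<Sum>a\<in>UNIV. \<Sum>b\<in>UNIV. \<Sum>c\<in>UNIV. \<Sum>d\<in>UNIV. of_bool (a * d - b * c = (1 :: 3)))"
    by (simp add: sum.cartesian_product case_prod_unfold del: sum_of_bool_eq)
  also have "\<dots> = 24" unfolding UNIV_3 by (simp del: sum_of_bool_eq)
  finally show ?thesis .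
qed

lemma SL2_3_square_eq_one:
  fixes t :: "3 mat2"
  assumes "t \<in> carrier SL2" "t \<otimes>\<^bsub>SL2\<^esub> t = \<one>\<^bsub>SL2\<^esub>"
  shows "t \<in> {(1, 0, 0, 1), (2, 0, 0, 2)}"
proof -
  obtain a b c d where t: "t = (a, b, c, d)" by (cases t)
  have "x = 0 \<or> x = 1 \<or> x = 2" for x :: 3 using UNIV_3 by blast
  from this[of a] this[of b] this[of c] this[of d] show ?thesis
    using assms unfolding t SL2_def mat2_mult_def by simp (elim disjE; simp)
qed

lemma not_metabelian_SL2_3: "\<not> metabelian (SL2 :: 3 mat2 monoid)"
proof
  interpret group "SL2 :: 3 mat2 monoid" by (rule group_SL2)
  let ?p = "(2, 2, 2, 1) :: 3 mat2" and ?q = "(2, 1, 1, 1) :: 3 mat2"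
  have commutator: "p \<in> derived_subgroup"
    if "a \<in> carrier SL2" "b \<in> carrier SL2" "p \<in> carrier SL2" "p \<otimes>\<^bsub>SL2\<^esub> (b \<otimes>\<^bsub>SL2\<^esub> a) = a \<otimes>\<^bsub>SL2\<^esub> b"
    for a b p :: "3 mat2"
  proof -
    have "p = a \<otimes>\<^bsub>SL2\<^esub> b \<otimes>\<^bsub>SL2\<^esub> inv\<^bsub>SL2\<^esub> a \<otimes>\<^bsub>SL2\<^esub> inv\<^bsub>SL2\<^esub> b"
      using that by (simp add: that(4)[symmetric] group_word_simps)
    then show ?thesis using commutator_mem_derived[OF that(1,2)] by simp
  qed
  have "?p \<in> derived_subgroup"
    by (rule commutator[of "(0, 1, 2, 0)" "(0, 1, 2, 1)"]) (simp_all add: SL2_def mat2_mult_def)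
  moreover have "?q \<in> derived_subgroup"
    by (rule commutator[of "(0, 1, 2, 0)" "(0, 1, 2, 2)"]) (simp_all add: SL2_def mat2_mult_def)
  moreover have "?p \<otimes>\<^bsub>SL2\<^esub> ?q \<noteq> ?q \<otimes>\<^bsub>SL2\<^esub> ?p" by (simp add: SL2_def mat2_mult_def)
  moreover assume "metabelian (SL2 :: 3 mat2 monoid)"
  ultimately show False by (auto simp: metabelian_iff)
qed

lemma exists_extremal_group:
  obtains G :: "nat monoid" where "group G" "finite (carrier G)" "tp G \<ge> 4 / 81" "\<not> metabelian G"
proof
  let ?S = "SL2 :: 3 mat2 monoid"
  let ?G = "image_group to_nat ?S :: nat monoid"
  interpret S: group ?S by (rule group_SL2)
  have inj: "inj_on to_nat (carrier ?S)" by (meson inj_on_subset inj_to_nat subset_UNIV)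
  show G: "group ?G" by (rule S.inj_imp_image_group_is_group[OF inj])
  have iso: "to_nat \<in> iso ?S ?G" by (rule inj_imp_image_group_iso[OF inj])
  interpret G: group ?G by (rule G)
  interpret to_nat: group_hom ?S ?G to_nat
    by (intro group_hom.intro group_hom_axioms.intro S.is_group G iso_imp_homomorphism iso)
  have carrier: "carrier ?G = to_nat ` carrier ?S" by (simp add: image_group_carrier)
  show "finite (carrier ?G)" by (simp add: carrier)
  show "\<not> metabelian ?G" using to_nat.metabelian_of_inj[OF inj] not_metabelian_SL2_3 by blast
  show "tp ?G \<ge> 4 / 81"
  proof (rule G.tp_ge_of_order_24)
    show "order ?G = 24" using iso_same_order[OF iso] order_SL2_3 by simp
    fix t a assume "t \<in> carrier ?G" "a \<in> carrier ?G" and square: "t \<otimes>\<^bsub>?G\<^esub> t = \<one>\<^bsub>?G\<^esub>"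
    then obtain s b where s: "s \<in> carrier ?S" "t = to_nat s" and b: "b \<in> carrier ?S" "a = to_nat b"
      by (auto simp: carrier)
    have "to_nat (s \<otimes>\<^bsub>?S\<^esub> s) = to_nat \<one>\<^bsub>?S\<^esub>"
      unfolding to_nat.hom_mult[OF s(1) s(1)] to_nat.hom_one using square s(2) by simp
    then have "s \<otimes>\<^bsub>?S\<^esub> s = \<one>\<^bsub>?S\<^esub>" by (rule injD[OF inj_to_nat])
    then have "s \<otimes>\<^bsub>?S\<^esub> b = b \<otimes>\<^bsub>?S\<^esub> s"
      using SL2_3_square_eq_one[OF s(1)] by (cases b) (auto simp: SL2_def mat2_mult_def mult.commute)
    then show "t \<otimes>\<^bsub>?G\<^esub> a = a \<otimes>\<^bsub>?G\<^esub> t"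
      using to_nat.hom_mult[OF s(1) b(1)] to_nat.hom_mult[OF b(1) s(1)] s(2) b(2) by argo
  qed
qed

theorem proposition4p14:
  shows "(\<forall>G :: ('a, 'b) monoid_scheme.
            group G \<and> finite (carrier G) \<and> \<not> comm_group G \<and> tp G > 4 / 81
              \<longrightarrow> solvable G \<and> derived_length_two G) \<and>
         \<not> (\<exists>c::real. c < 4 / 81 \<and>
            (\<forall>G :: nat monoid.
               group G \<and> finite (carrier G) \<and> \<not> comm_group G \<and> tp G > c
                 \<longrightarrow> derived_length_two G))"
proof (intro conjI allI impI)
  fix G :: "('a, 'b) monoid_scheme"
  assume G: "group G \<and> finite (carrier G) \<and> \<not> comm_group G \<and> tp G > 4 / 81"
  then interpret high_tp_group G by (simp add: high_tp_group_def high_tp_group_axioms_def)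
  show "derived_length_two G"
    using metabelian_of_high_tp comm_group_iff_derived G by (simp add: derived_length_two_def metabelian_def)
  have "(derived G ^^ 2) (carrier G) = {\<one>\<^bsub>G\<^esub>}"
    using metabelian_of_high_tp by (simp add: metabelian_def numeral_2_eq_2)
  then show "solvable G" using solvable_iff_trivial_derived_seq by blast
next
  obtain G :: "nat monoid" where G: "group G" "finite (carrier G)" "tp G \<ge> 4 / 81" "\<not> metabelian G"
    by (rule exists_extremal_group)
  have "\<not> comm_group G" "\<not> derived_length_two G"
    using G(4) group.comm_group_imp_metabelian[OF G(1)] by (auto simp: derived_length_two_def metabelian_def)
  then show "\<not> (\<exists>c::real. c < 4 / 81 \<and> (\<forall>G :: nat monoid.
      group G \<and> finite (carrier G) \<and> \<not> comm_group G \<and> tp G > c \<longrightarrow> derived_length_two G))"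
    using G by (meson less_le_trans)
qed

end
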